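(* Let $\Delta=\{z\in\mathbb{C}_z : |z|<1\}$. There exists a compact subset $E$ of $\bar{\Delta}\times\mathbb{C}_w\subset\mathbb{C}^2_{z,w}$ whose fibers $E(z)=\{w\in\mathbb{C}_w : (z,w)\in E\}$, $z\in\bar\Delta$, are finite, nonempty and depend continuously on $z\in\bar{\Delta}$ in the Hausdorff metric, such that $$H_1\big((\Delta\times\mathbb{C}_w)\setminus E,\mathbb{Z}\big)=0,$$ and, in particular, there is a neighbourhood $U(E)$ of $E$ which does not contain any subset of $\bar{\Delta}\times\mathbb{C}_w$ defined by a Weierstrass pseudopolynomial.
   Context: For bounded nonempty sets $E_1,E_2\subset\mathbb{C}_w$ the Hausdorff distance is $$d(E_1,E_2)=\sup_{w_2\in E_2}\inf_{w_1\in E_1}|w_1-w_2|+\sup_{w_2\in E_1}\inf_{w_1\in E_2}|w_1-w_2|.$$ A family of compact sets $E(z)\subset\mathbb{C}_w$, $z\in\bar\Delta$, depends continuously on $z$ in the Hausdorff metric if for each sequence $\{z_j\}$ in $\bar\Delta$ converging to a point $z_0\in\bar\Delta$ one has $d(E(z_j),E(z_0))\to 0$ as $j\to\infty$. $H_1(\cdot,\mathbb{Z})$ denotes the first singular homology group with integer coefficients. A subset of $\bar\Delta\times\mathbb{C}_w$ is defined by a Weierstrass pseudopolynomial if it has the form $$\{(z,w)\in\bar\Delta\times\mathbb{C}_w : w^m+a_1(z)w^{m-1}+\dots+a_m(z)=0\}$$ for some integer $m\ge1$ and some continuous functions $a_1,\dots,a_m:\bar\Delta\to\mathbb{C}$.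 *)

theory Defs
  imports "HOL-Analysis.Analysis" "HOL-Homology.Homology"
begin

definition fiber :: "(complex \<times> complex) set \<Rightarrow> complex \<Rightarrow> complex set"
  where "fiber E z = {w. (z, w) \<in> E}"

text \<open>
  The Hausdorff distance is normalised as the sum, not the maximum, of the two one-sided
  excesses. The real \<open>SUP\<close> and \<open>INF\<close> are meaningful only for bounded nonempty arguments.
\<close>

definition hausdorff_distance :: "complex set \<Rightarrow> complex set \<Rightarrow> real"
  where "hausdorff_distance E1 E2 =
    (SUP w2\<in>E2. INF w1\<in>E1. cmod (w1 - w2)) + (SUP w2\<in>E1. INF w1\<in>E2. cmod (w1 - w2))"

definition hausdorff_continuous_on :: "complex set \<Rightarrow> (complex \<Rightarrow> complex set) \<Rightarrow> bool"
  where "hausdorff_continuous_on D F \<longleftrightarrow>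
    (\<forall>z z0. (\<forall>j::nat. z j \<in> D) \<longrightarrow> z0 \<in> D \<longrightarrow> z \<longlonglongrightarrow> z0 \<longrightarrow>
      (\<lambda>j. hausdorff_distance (F (z j)) (F z0)) \<longlonglongrightarrow> 0)"

definition weierstrass_pseudopolynomial_set :: "(complex \<times> complex) set \<Rightarrow> bool"
  where "weierstrass_pseudopolynomial_set S \<longleftrightarrow>
    (\<exists>(m::nat) (a :: nat \<Rightarrow> complex \<Rightarrow> complex).
      m \<ge> 1 \<and> (\<forall>k\<in>{1..m}. continuous_on (cball 0 1) (a k)) \<and>
      S = {(z, w). z \<in> cball 0 1 \<and> w ^ m + (\<Sum>k=1..m. a k z * w ^ (m - k)) = 0})"

end

theory Submission
  imports Defs "HOL-Complex_Analysis.Complex_Analysis" "HOL-Computational_Algebra.Fundamental_Theorem_Algebra"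
begin

text \<open>The set \<open>E\<close> of the theorem is a surface with two kinds of sheets. Over the right part of the disc
  it is the graph of a square root with a branch point at \<open>z = 1/2\<close>, over the left part the graph of a
  (real-linearly distorted) cube root with a branch point at \<open>z = -1/2\<close>. Over the strip
  \<open>\<bar>Re z\<bar> \<le> 1/4\<close> there are just the two constant sheets \<open>1\<close> and \<open>-1/2\<close>, where the distortion has pinched
  two of the three cubic sheets together into \<open>-1/2\<close>. Thus \<open>E\<close> is the zero set of a monic quadratic in
  \<open>w\<close> over \<open>Re z > -1/4\<close>, equal to \<open>(w - 1) (w + 1/2)\<close> over the strip, and of a monic cubic over
  \<open>Re z < 1/4\<close>, equal to \<open>(w - 1) (w + 1/2)\<^sup>2\<close> over the strip. Hausdorff continuity is the continuity of
  the roots of monic polynomials.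

  Heuristically, a pseudopolynomial with zeros near \<open>E\<close> assigns to each sheet the number of zeros near
  it. By monodromy this is one number \<open>a\<close> for all cubic sheets and one number \<open>d\<close> for both quadratic
  sheets. Crossing the strip along the sheet \<open>1\<close> gives \<open>a = d\<close>, and along the sheet \<open>-1/2\<close> it gives
  \<open>2 a = d\<close>. So \<open>a = d = 0\<close>, and there are no zeros at all.

  The proof turns this count into homotopy. Over either side, a loop in the complement of \<open>E\<close> is
  determined up to free homotopy by the winding number of the polynomial of that side along it
  (\<open>loops_classified_by_winding\<close>). A loop over \<open>z = 0\<close> that runs \<open>-n\<close> times around \<open>1\<close> and \<open>n\<close> times around
  \<open>-1/2\<close> has cubic winding number \<open>-n + 2 n = n\<close> and quadratic winding number \<open>-n + n = 0\<close>. So every loop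
  over the left side is homotopic to such a loop and hence trivial on the right side. Running
  \<open>2 n\<close> and \<open>-n\<close> times exchanges the roles, and a van Kampen argument (\<open>simply_connected_Un\<close>) makes the
  complement \<open>X\<close> of \<open>E\<close> over the open disc simply connected. Then \<open>H\<^sub>1(X) = 0\<close> by the easy half of the
  Hurewicz theorem (\<open>trivial_homology_group_simply_connected\<close>).

  For the neighbourhood, contract the loop \<open>\<bar>w\<bar> = R\<close> over \<open>z = 0\<close> in \<open>X\<close>, where \<open>E\<close> lies in
  \<open>\<bar>w\<bar> < R\<close>. The contraction has a compact image \<open>K\<close> disjoint from \<open>E\<close>. A pseudopolynomial of degree
  \<open>m\<close> with all zeros in \<open>{\<bar>w\<bar> < R} - K\<close> does not vanish along the contraction, although its winding
  number along the loop is \<open>m \<ge> 1\<close> (\<open>neighbourhood_without_pseudopolynomial\<close>).\<close>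

section \<open>First homology of simply connected sets\<close>

text \<open>Singular simplices are functions on sequences of barycentric coordinates. Paths, and maps on the
  triangle of points \<open>(a, b)\<close> with \<open>a, b \<ge> 0\<close> and \<open>a + b \<le> 1\<close>, are easier to work with, and they become
  simplices when the coordinate of index \<open>0\<close> is dropped.\<close>

definition segment_simplex :: "(real \<Rightarrow> 'a) \<Rightarrow> (nat \<Rightarrow> real) \<Rightarrow> 'a"
  where "segment_simplex g = restrict (\<lambda>x. g (x 1)) (standard_simplex 1)"

definition triangle_simplex :: "(real \<times> real \<Rightarrow> 'a) \<Rightarrow> (nat \<Rightarrow> real) \<Rightarrow> 'a"
  where "triangle_simplex G = restrict (\<lambda>x. G (x 1, x 2)) (standard_simplex 2)"

abbreviation point_simplex :: "'a \<Rightarrow> (nat \<Rightarrow> real) \<Rightarrow> 'a"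
  where "point_simplex a \<equiv> restrict (\<lambda>_. a) (standard_simplex 0)"

abbreviation std_triangle :: "(real \<times> real) set"
  where "std_triangle \<equiv> {(a, b). 0 \<le> a \<and> 0 \<le> b \<and> a + b \<le> 1}"

lemma continuous_map_simplex_coordinate:
  "continuous_map (subtopology (powertop_real UNIV) (standard_simplex n)) euclideanreal (\<lambda>x. x i)"
  by (auto intro: continuous_map_from_subtopology continuous_map_product_projection)

lemma standard_simplex_1_iff:
  "x \<in> standard_simplex (Suc 0) \<longleftrightarrow>
     0 \<le> x (Suc 0) \<and> x (Suc 0) \<le> 1 \<and> x 0 = 1 - x (Suc 0) \<and> (\<forall>i>Suc 0. x i = 0)"
proof
  assume "0 \<le> x (Suc 0) \<and> x (Suc 0) \<le> 1 \<and> x 0 = 1 - x (Suc 0) \<and> (\<forall>i>Suc 0. x i = 0)"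
  then show "x \<in> standard_simplex (Suc 0)"
    unfolding standard_simplex_def
    by (simp, metis One_nat_def Suc_lessI diff_ge_0_iff_ge gr0I le_add_same_cancel1 add.commute diff_add_cancel dual_order.refl zero_le_one)
qed (auto simp: standard_simplex_def)

lemma standard_simplex_2_imp:
  "x \<in> standard_simplex 2 \<Longrightarrow> (x 1, x 2) \<in> std_triangle"
  by (auto simp: standard_simplex_def numeral_2_eq_2) (metis add_increasing2 add.commute add_le_cancel_left le_add_same_cancel1)

lemma singular_simplex_triangle:
  assumes "continuous_on std_triangle G" "G ` std_triangle \<subseteq> S"
  shows "singular_simplex 2 (top_of_set S) (triangle_simplex G)"
proof -
  have 1: "continuous_map (subtopology (powertop_real UNIV) (standard_simplex 2)) (top_of_set std_triangle) (\<lambda>x. (x 1, x 2))"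
    using standard_simplex_2_imp continuous_map_simplex_coordinate [of 2]
    by (auto simp: continuous_map_in_subtopology continuous_map_paired simp flip: prod_topology_euclidean)
  have 2: "continuous_map (top_of_set std_triangle) (top_of_set S) G"
    using assms by auto
  have "continuous_map (subtopology (powertop_real UNIV) (standard_simplex 2)) (top_of_set S) (\<lambda>x. G (x 1, x 2))"
    using continuous_map_compose [OF 1 2] by (simp add: o_def)
  then show ?thesis
    unfolding singular_simplex_def triangle_simplex_def
    by (auto intro: continuous_map_eq)
qed

lemma chain_boundary_segment:
  "chain_boundary 1 (frag_of (segment_simplex g))
     = frag_of (point_simplex (g 1)) - frag_of (point_simplex (g 0))"
proof -
  have *: "simplical_face k x \<in> standard_simplex 1" if "x \<in> standard_simplex 0" "k \<le> 1" for x :: "nat \<Rightarrow> real" and k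
    using simplical_face_in_standard_simplex [of 1 k x] that by simp
  have "singular_face 1 0 (segment_simplex g) = point_simplex (g 1)"
    "singular_face 1 1 (segment_simplex g) = point_simplex (g 0)"
    using * [of _ 0] * [of _ 1]
    by (auto simp: singular_face_def segment_simplex_def fun_eq_iff restrict_def)
      (auto simp: simplical_face_def standard_simplex_0)
  then show ?thesis
    by (simp add: chain_boundary_of)
qed

lemma chain_boundary_triangle:
  "chain_boundary 2 (frag_of (triangle_simplex G))
     = frag_of (segment_simplex (\<lambda>u. G (1 - u, u))) - frag_of (segment_simplex (\<lambda>u. G (0, u)))
       + frag_of (segment_simplex (\<lambda>u. G (u, 0)))"
proof -
  have *: "simplical_face k x \<in> standard_simplex 2" if "x \<in> standard_simplex 1" "k \<le> 2" for x :: "nat \<Rightarrow> real" and k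
    using simplical_face_in_standard_simplex [of 2 k x] that by simp
  have "singular_face 2 0 (triangle_simplex G) = segment_simplex (\<lambda>u. G (1 - u, u))"
    "singular_face 2 1 (triangle_simplex G) = segment_simplex (\<lambda>u. G (0, u))"
    "singular_face 2 2 (triangle_simplex G) = segment_simplex (\<lambda>u. G (u, 0))"
    using * [of _ 0] * [of _ 1] * [of _ 2]
    by (auto simp: singular_face_def segment_simplex_def triangle_simplex_def fun_eq_iff restrict_def
        simplical_face_def standard_simplex_1_iff)
  then show ?thesis
    by (simp add: chain_boundary_of numeral_2_eq_2 algebra_simps)
qed

lemma singular_simplex_1_is_segment:
  assumes "singular_simplex 1 (top_of_set S) \<sigma>"
  obtains g where "path g" "path_image g \<subseteq> S" "\<sigma> = segment_simplex g"
proof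
  define e :: "real \<Rightarrow> nat \<Rightarrow> real" where "e = (\<lambda>u i. if i = 0 then 1 - u else if i = 1 then u else 0)"
  have e: "e u \<in> standard_simplex 1" if "u \<in> {0..1}" for u
    using that by (auto simp: standard_simplex_1_iff e_def)
  have "continuous_map (top_of_set {0..1}) (powertop_real UNIV) e"
  proof (clarsimp simp: continuous_map_componentwise_UNIV)
    fix i show "continuous_on {0..1} (\<lambda>u. e u i)"
      by (cases "i = 0"; cases "i = 1") (auto simp: e_def intro!: continuous_intros)
  qed
  then have 1: "continuous_map (top_of_set {0..1}) (subtopology (powertop_real UNIV) (standard_simplex 1)) e"
    using e by (auto simp: continuous_map_in_subtopology)
  have 2: "continuous_map (subtopology (powertop_real UNIV) (standard_simplex 1)) (top_of_set S) \<sigma>"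
    using assms by (auto simp: singular_simplex_def)
  have "continuous_map (top_of_set {0..1}) (top_of_set S) (\<sigma> \<circ> e)"
    using continuous_map_compose [OF 1 2] .
  then show "path (\<sigma> \<circ> e)" "path_image (\<sigma> \<circ> e) \<subseteq> S"
    by (auto simp: path_def path_image_def)
  have "e (x 1) = x" if "x \<in> standard_simplex 1" for x
    using that by (auto simp: standard_simplex_1_iff e_def fun_eq_iff)
  moreover have "\<sigma> x = undefined" if "x \<notin> standard_simplex 1" for x
    using assms that by (simp add: singular_simplex_def extensional_def)
  ultimately have "\<sigma> x = segment_simplex (\<sigma> \<circ> e) x" for x
    by (cases "x \<in> standard_simplex 1") (simp_all add: segment_simplex_def)
  then show "\<sigma> = segment_simplex (\<sigma> \<circ> e)" ..
qed

lemma segment_simplex_cong: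
  "(\<And>u. u \<in> {0..1} \<Longrightarrow> g u = h u) \<Longrightarrow> segment_simplex g = segment_simplex h"
  by (auto simp: segment_simplex_def restrict_def standard_simplex_def fun_eq_iff)

text \<open>All the relations between paths that the computation of \<open>H\<^sub>1\<close> needs are read off from the boundary of
  a single triangle.\<close>

lemma triangle_relation:
  assumes "continuous_on std_triangle G" "G ` std_triangle \<subseteq> S"
  shows "singular_relboundary 1 (top_of_set S) {}
     (frag_of (segment_simplex (\<lambda>u. G (1 - u, u))) - frag_of (segment_simplex (\<lambda>u. G (0, u)))
       + frag_of (segment_simplex (\<lambda>u. G (u, 0))))"
proof -
  have "singular_chain 2 (top_of_set S) (frag_of (triangle_simplex G))"
    using singular_simplex_triangle [OF assms] by (simp add: singular_chain_of)
  then show ?thesis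
    unfolding singular_boundary
    by (metis Suc_1 chain_boundary_triangle)
qed

lemma const_segment_boundary:
  assumes "a \<in> S"
  shows "singular_relboundary 1 (top_of_set S) {} (frag_of (segment_simplex (\<lambda>u. a)))"
  using triangle_relation [of "\<lambda>_. a" S] assms by force

text \<open>The map \<open>(a, b) \<mapsto> (p +++ q) (a/2 + b)\<close> is \<open>p\<close>, \<open>q\<close> and \<open>p +++ q\<close> on the three edges of the triangle.\<close>

lemma homologous_join:
  assumes p: "path p" "path_image p \<subseteq> S" and q: "path q" "path_image q \<subseteq> S"
    and pq: "pathfinish p = pathstart q"
  shows "homologous_rel 1 (top_of_set S) {} (frag_of (segment_simplex (p +++ q)))
          (frag_of (segment_simplex p) + frag_of (segment_simplex q))"
proof -
  let ?r = "p +++ q"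
  define G where "G = (\<lambda>x. ?r (fst x / 2 + snd x))"
  have r: "path ?r" "path_image ?r \<subseteq> S"
    using assms by (auto simp: path_image_join)
  have im: "fst x / 2 + snd x \<in> {0..1}" if "x \<in> std_triangle" for x
    using that by auto
  have "continuous_on std_triangle G"
    unfolding G_def
    by (rule continuous_on_compose2 [of "{0..1}" ?r])
      (use r im in \<open>auto simp: path_def intro!: continuous_intros\<close>)
  moreover have "G ` std_triangle \<subseteq> S"
    using r(2) im unfolding G_def path_image_def by blast
  ultimately have *: "singular_relboundary 1 (top_of_set S) {}
     (frag_of (segment_simplex (\<lambda>u. G (1 - u, u))) - frag_of (segment_simplex (\<lambda>u. G (0, u)))
       + frag_of (segment_simplex (\<lambda>u. G (u, 0))))"
    by (rule triangle_relation)
  have 1: "segment_simplex (\<lambda>u. G (1 - u, u)) = segment_simplex q"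
  proof (rule segment_simplex_cong)
    fix u :: real assume u: "u \<in> {0..1}"
    show "G (1 - u, u) = q u"
    proof (cases "u = 0")
      case True
      then show ?thesis using pq by (simp add: G_def joinpaths_def pathfinish_def pathstart_def)
    next
      case False
      have "(1 - u) / 2 + u = (1 + u) / 2" by (simp add: field_simps)
      moreover have "\<not> (1 + u) / 2 \<le> 1 / 2" "2 * ((1 + u) / 2) - 1 = u"
        using u False by (simp_all add: field_simps)
      then have "?r ((1 + u) / 2) = q u"
        by (simp only: joinpaths_def if_False)
      ultimately show ?thesis by (simp only: G_def fst_conv snd_conv)
    qed
  qed
  have 2: "segment_simplex (\<lambda>u. G (0, u)) = segment_simplex ?r"
    by (simp add: G_def)
  have 3: "segment_simplex (\<lambda>u. G (u, 0)) = segment_simplex p"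
    by (rule segment_simplex_cong) (auto simp: G_def joinpaths_def)
  show ?thesis
    unfolding homologous_rel_sym [of _ _ _ "frag_of (segment_simplex ?r)"]
    using * unfolding 1 2 3 homologous_rel_def by (simp add: algebra_simps)
qed

text \<open>The diagonal cuts the square of the homotopy into two triangles. The two sides on which the
  homotopy is constant are boundaries.\<close>

lemma homologous_homotopic_paths:
  assumes "homotopic_paths S p q"
  shows "homologous_rel 1 (top_of_set S) {} (frag_of (segment_simplex p)) (frag_of (segment_simplex q))"
proof -
  obtain h where h: "continuous_on ({0..1} \<times> {0..1}) h" "h ` ({0..1} \<times> {0..1}) \<subseteq> S"
    and h0: "\<And>x. x \<in> {0..1} \<Longrightarrow> h (0,x) = p x" and h1: "\<And>x. x \<in> {0..1} \<Longrightarrow> h (1,x) = q x"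
    and st: "\<And>t::real. t \<in> {0..1} \<Longrightarrow> h (t,0) = p 0 \<and> h (t,1) = p 1"
    using assms unfolding homotopic_paths pathstart_def pathfinish_def
    by (auto simp: image_subset_iff_funcset)
  define G1 where "G1 = (\<lambda>x::real\<times>real. h (snd x, fst x + snd x))"
  define G2 where "G2 = (\<lambda>x::real\<times>real. h (fst x + snd x, snd x))"
  have c: "continuous_on std_triangle G1" "continuous_on std_triangle G2"
    unfolding G1_def G2_def
    by (rule continuous_on_compose2 [OF h(1)], (intro continuous_intros)[1], force)+
  have i: "G1 ` std_triangle \<subseteq> S" "G2 ` std_triangle \<subseteq> S"
    using h(2) by (auto simp: G1_def G2_def image_subset_iff)
  have pS: "p 0 \<in> S" "p 1 \<in> S"
    using homotopic_paths_imp_subset [OF assms] by (auto simp: path_image_def)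
  have sides: "segment_simplex (\<lambda>u. h (u, 1)) = segment_simplex (\<lambda>u. p 1)"
    "segment_simplex (\<lambda>u. h (u, 0)) = segment_simplex (\<lambda>u. p 0)"
    "segment_simplex (\<lambda>u. h (0, u)) = segment_simplex p"
    "segment_simplex (\<lambda>u. h (1, u)) = segment_simplex q"
    using st h0 h1 by (intro segment_simplex_cong; simp)+
  have R1: "singular_relboundary 1 (top_of_set S) {}
     (frag_of (segment_simplex (\<lambda>u. p 1)) - frag_of (segment_simplex (\<lambda>u. h (u, u)))
       + frag_of (segment_simplex p))"
    using triangle_relation [OF c(1) i(1)] by (simp add: G1_def sides)
  have R2: "singular_relboundary 1 (top_of_set S) {}
     (frag_of (segment_simplex q) - frag_of (segment_simplex (\<lambda>u. h (u, u)))
       + frag_of (segment_simplex (\<lambda>u. p 0)))"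
    using triangle_relation [OF c(2) i(2)] by (simp add: G2_def sides)
  have "singular_relboundary 1 (top_of_set S) {}
     ((frag_of (segment_simplex (\<lambda>u. p 1)) - frag_of (segment_simplex (\<lambda>u. h (u, u)))
       + frag_of (segment_simplex p)) - (frag_of (segment_simplex q) - frag_of (segment_simplex (\<lambda>u. h (u, u)))
       + frag_of (segment_simplex (\<lambda>u. p 0))) - frag_of (segment_simplex (\<lambda>u. p 1)) + frag_of (segment_simplex (\<lambda>u. p 0)))"
    by (intro singular_relboundary_diff singular_relboundary_add R1 R2 const_segment_boundary pS)
  then show ?thesis
    by (simp add: homologous_rel_def algebra_simps)
qed

text \<open>Join a base point to every point \<open>x\<close> by a path \<open>\<gamma> x\<close>. A path \<open>g\<close> from \<open>x\<close> to \<open>y\<close> is homologous to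
  \<open>\<gamma> y - \<gamma> x\<close>, because \<open>\<gamma> x +++ g\<close> is homotopic to \<open>\<gamma> y\<close>. By linearity every 1-chain \<open>c\<close> is homologous
  to \<open>\<Gamma> (\<partial>c)\<close>, where \<open>\<Gamma>\<close> sends the point \<open>x\<close> to \<open>\<gamma> x\<close>, and this is \<open>0\<close> for a cycle.\<close>

theorem trivial_homology_group_simply_connected:
  fixes S :: "'a::real_normed_vector set"
  assumes S: "simply_connected S"
  shows "trivial_group (homology_group 1 (top_of_set S))"
proof -
  let ?X = "top_of_set S"
  have bd: "singular_relboundary 1 ?X {} c" if c: "singular_relcycle 1 ?X {} c" for c
  proof (cases "S = {}")
    case True
    then have "c = 0"
      using c by (simp add: singular_cycle singular_chain_empty)
    then show ?thesis by simp
  next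
    case False
    then obtain x0 where x0: "x0 \<in> S" by blast
    have "\<exists>g. path g \<and> path_image g \<subseteq> S \<and> pathstart g = x0 \<and> pathfinish g = x" if "x \<in> S" for x
      using simply_connected_imp_path_connected [OF S] x0 that by (auto simp: path_connected_def)
    then obtain \<gamma> where \<gamma>: "\<And>x. x \<in> S \<Longrightarrow> path (\<gamma> x) \<and> path_image (\<gamma> x) \<subseteq> S \<and> pathstart (\<gamma> x) = x0 \<and> pathfinish (\<gamma> x) = x"
      by metis
    define \<Gamma> where "\<Gamma> = (\<lambda>f::(nat \<Rightarrow> real) \<Rightarrow> 'a. frag_of (segment_simplex (\<gamma> (f (\<lambda>j. if j = 0 then 1 else 0)))))"
    have \<Gamma>: "\<Gamma> (point_simplex x) = frag_of (segment_simplex (\<gamma> x))" for x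
      by (simp add: \<Gamma>_def)
    have ex: "\<exists>d. singular_chain 2 ?X d \<and> chain_boundary 2 d = frag_of \<sigma> - frag_extend \<Gamma> (chain_boundary 1 (frag_of \<sigma>))"
      if "singular_simplex 1 ?X \<sigma>" for \<sigma>
    proof -
      obtain g where g: "path g" "path_image g \<subseteq> S" "\<sigma> = segment_simplex g"
        by (rule singular_simplex_1_is_segment [OF \<open>singular_simplex 1 ?X \<sigma>\<close>])
      have ends: "g 0 \<in> S" "g 1 \<in> S"
        using g by (auto simp: path_image_def)
      have join: "homologous_rel 1 ?X {} (frag_of (segment_simplex (\<gamma> (g 0) +++ g))) (frag_of (segment_simplex (\<gamma> (g 0))) + frag_of \<sigma>)"
        using homologous_join [of "\<gamma> (g 0)" S g] g \<gamma> [OF ends(1)] by (simp add: pathstart_def)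
      have "pathstart g = g 0" "pathfinish g = g 1"
        by (simp_all add: pathstart_def pathfinish_def)
      then have "homotopic_paths S (\<gamma> (g 0) +++ g) (\<gamma> (g 1))"
        using S \<gamma> [OF ends(1)] \<gamma> [OF ends(2)] g
        unfolding simply_connected_eq_homotopic_paths
        by (simp add: path_image_join)
      then have "homologous_rel 1 ?X {} (frag_of (segment_simplex (\<gamma> (g 0) +++ g))) (frag_of (segment_simplex (\<gamma> (g 1))))"
        by (rule homologous_homotopic_paths)
      from homologous_rel_trans [OF this iffD1 [OF homologous_rel_sym join]]
      have "homologous_rel 1 ?X {} (frag_of (segment_simplex (\<gamma> (g 0))) + frag_of \<sigma>) (frag_of (segment_simplex (\<gamma> (g 1))))" .
      then have "singular_relboundary 1 ?X {} (frag_of \<sigma> - frag_extend \<Gamma> (chain_boundary 1 (frag_of \<sigma>)))"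
        unfolding homologous_rel_def g(3) chain_boundary_segment frag_extend_diff frag_extend_of \<Gamma>
        by (simp add: algebra_simps)
      then show ?thesis
        by (simp add: singular_boundary numeral_2_eq_2)
    qed
    define d where "d = (\<lambda>\<sigma>. SOME d. singular_chain 2 ?X d \<and> chain_boundary 2 d = frag_of \<sigma> - frag_extend \<Gamma> (chain_boundary 1 (frag_of \<sigma>)))"
    have d: "singular_chain 2 ?X (d \<sigma>)" "chain_boundary 2 (d \<sigma>) = frag_of \<sigma> - frag_extend \<Gamma> (chain_boundary 1 (frag_of \<sigma>))"
      if "singular_simplex 1 ?X \<sigma>" for \<sigma>
      using someI_ex [OF ex [OF that]] unfolding d_def by auto
    have keys: "Poly_Mapping.keys c \<subseteq> singular_simplex_set 1 ?X"
      using c by (simp add: singular_cycle singular_chain_def)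
    have "chain_boundary 2 (frag_extend d c) = c - frag_extend \<Gamma> (chain_boundary 1 c)"
      using keys
    proof (induction c rule: frag_induction)
      case (diff a b)
      then show ?case
        by (simp add: frag_extend_diff chain_boundary_diff)
    qed (use d in auto)
    also have "\<dots> = c"
      using c by (simp add: singular_cycle)
    finally have "chain_boundary 2 (frag_extend d c) = c" .
    moreover have "singular_chain 2 ?X (frag_extend d c)"
      using keys d by (intro singular_chain_extend) auto
    ultimately show ?thesis
      unfolding singular_boundary by (metis Suc_1)
  qed
  let ?B = "singular_relboundary_set 1 ?X {}"
  have "homologous_rel_set 1 ?X {} c = ?B" if "singular_relcycle 1 ?X {} c" for c
    using bd [OF that] by (simp only: homologous_rel_set_eq_relboundary)
  then have "homologous_rel_set 1 ?X {} ` singular_relcycle_set 1 ?X {} = (\<lambda>_. ?B) ` singular_relcycle_set 1 ?X {}"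
    by (intro image_cong) auto
  also have "\<dots> = {?B}"
    using singular_relcycle_0 [of 1 ?X "{}"] by blast
  finally have "carrier (homology_group (int 1) ?X) = {?B}"
    by (simp only: carrier_relative_homology_group)
  moreover have "\<one>\<^bsub>homology_group (int 1) ?X\<^esub> = ?B"
    by (rule one_relative_homology_group)
  moreover have "group (homology_group (int 1) ?X)"
    by simp
  ultimately show ?thesis
    by (simp only: trivial_group_def of_nat_1)
qed

section \<open>A van Kampen argument for simple connectivity\<close>

text \<open>The loops in \<open>U\<close> and in \<open>V\<close> need only be contractible in the union \<open>X\<close>. Choose for every point \<open>x\<close> a
  tail \<open>\<tau> x\<close> from a base point in \<open>U \<inter> V\<close> that stays inside each of \<open>U\<close> and \<open>V\<close> that contains \<open>x\<close>. Then
  \<open>\<tau> (p 0) +++ p\<close> is homotopic to \<open>\<tau> (p 1)\<close> for every short path \<open>p\<close>, hence for every path by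
  subdivision, and for a loop this says that it is contractible.\<close>

lemma simply_connected_Un:
  fixes X :: "'a::real_normed_vector set"
  assumes X: "X = U \<union> V" and opU: "openin (top_of_set X) U" and opV: "openin (top_of_set X) V"
    and pcU: "path_connected U" and pcV: "path_connected V" and pcUV: "path_connected (U \<inter> V)"
    and ne: "U \<inter> V \<noteq> {}"
    and nullU: "\<And>p. \<lbrakk>path p; path_image p \<subseteq> U; pathfinish p = pathstart p\<rbrakk> \<Longrightarrow> \<exists>a. homotopic_loops X p (linepath a a)"
    and nullV: "\<And>p. \<lbrakk>path p; path_image p \<subseteq> V; pathfinish p = pathstart p\<rbrakk> \<Longrightarrow> \<exists>a. homotopic_loops X p (linepath a a)"
  shows "simply_connected X"
proof -
  obtain b where b: "b \<in> U" "b \<in> V" using ne by blast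
  have same_ends: "homotopic_paths X p q"
    if pq: "path p" "path q" "pathstart q = pathstart p" "pathfinish q = pathfinish p"
      "path_image p \<union> path_image q \<subseteq> W" and W: "W = U \<or> W = V" for p q W
  proof -
    have "path (p +++ reversepath q)" "path_image (p +++ reversepath q) \<subseteq> W"
      "pathfinish (p +++ reversepath q) = pathstart (p +++ reversepath q)"
      using pq by (auto simp: path_image_join)
    then obtain a where "homotopic_loops X (p +++ reversepath q) (linepath a a)"
      using nullU nullV W by blast
    then show ?thesis
      using homotopic_paths_loop_parts pq(2) by blast
  qed
  have "\<exists>g. path g \<and> pathstart g = b \<and> pathfinish g = x \<and> (x \<in> U \<longrightarrow> path_image g \<subseteq> U) \<and> (x \<in> V \<longrightarrow> path_image g \<subseteq> V)"
    if xX: "x \<in> X" for x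
  proof -
    consider "x \<in> U \<inter> V" | "x \<in> U" "x \<notin> V" | "x \<in> V" "x \<notin> U"
      using xX X by blast
    then show ?thesis
    proof cases
      case 1
      with pcUV b obtain g where "path g" "path_image g \<subseteq> U \<inter> V" "pathstart g = b" "pathfinish g = x"
        unfolding path_connected_def by blast
      then show ?thesis by blast
    next
      case 2
      with pcU b obtain g where "path g" "path_image g \<subseteq> U" "pathstart g = b" "pathfinish g = x"
        unfolding path_connected_def by blast
      with 2 show ?thesis by blast
    next
      case 3
      with pcV b obtain g where "path g" "path_image g \<subseteq> V" "pathstart g = b" "pathfinish g = x"
        unfolding path_connected_def by blast
      with 3 show ?thesis by blast
    qed
  qed
  then have "\<forall>x\<in>X. \<exists>g. path g \<and> pathstart g = b \<and> pathfinish g = x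
       \<and> (x \<in> U \<longrightarrow> path_image g \<subseteq> U) \<and> (x \<in> V \<longrightarrow> path_image g \<subseteq> V)"
    by blast
  from bchoice [OF this] obtain \<tau> where \<tau>: "\<And>x. x \<in> X \<Longrightarrow> path (\<tau> x)" "\<And>x. x \<in> X \<Longrightarrow> pathstart (\<tau> x) = b"
      "\<And>x. x \<in> X \<Longrightarrow> pathfinish (\<tau> x) = x"
      "\<And>x. x \<in> X \<Longrightarrow> x \<in> U \<Longrightarrow> path_image (\<tau> x) \<subseteq> U" "\<And>x. x \<in> X \<Longrightarrow> x \<in> V \<Longrightarrow> path_image (\<tau> x) \<subseteq> V"
    by blast
  have \<tau>X: "path_image (\<tau> x) \<subseteq> X" if "x \<in> X" for x
    using \<tau>(4,5) [OF that] that X by blast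
  have tails: "homotopic_paths X (\<tau> (p 0) +++ p) (\<tau> (p 1))" if p: "path p" "path_image p \<subseteq> X" for p
  proof -
    define P where "P = (\<lambda>s t. 0 \<le> s \<longrightarrow> t \<le> 1 \<longrightarrow> s \<le> t \<longrightarrow> homotopic_paths X (\<tau> (p s) +++ subpath s t p) (\<tau> (p t)))"
    have pX: "p t \<in> X" if "t \<in> {0..1}" for t
      using p that by (auto simp: path_image_def)
    have "P 0 1"
      using zero_le_one
    proof (induction rule: Bolzano)
      case (trans r s t)
      show ?case
        unfolding P_def
      proof (intro impI)
        assume rt: "0 \<le> r" "t \<le> 1" "r \<le> t"
        have sub: "path (subpath u v p)" "path_image (subpath u v p) \<subseteq> X" if "u \<in> {0..1}" "v \<in> {0..1}" for u v
          using p that path_image_subpath_subset [of u v p] by auto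
        have in01: "r \<in> {0..1}" "s \<in> {0..1}" "t \<in> {0..1}"
          using trans rt by auto
        have X: "p r \<in> X" "p s \<in> X" "p t \<in> X"
          using pX in01 by auto
        have "homotopic_paths X (\<tau> (p r) +++ subpath r t p) (\<tau> (p r) +++ (subpath r s p +++ subpath s t p))"
          using homotopic_join_subpaths [OF p in01] \<tau> X \<tau>X
          by (intro homotopic_paths_join) (auto simp: homotopic_paths_sym_eq)
        also have "homotopic_paths X \<dots> ((\<tau> (p r) +++ subpath r s p) +++ subpath s t p)"
          using \<tau> X \<tau>X sub in01 by (intro homotopic_paths_assoc) auto
        also have "homotopic_paths X \<dots> (\<tau> (p s) +++ subpath s t p)"
          using trans rt \<tau> X \<tau>X sub in01 by (intro homotopic_paths_join) (auto simp: P_def)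
        also have "homotopic_paths X \<dots> (\<tau> (p t))"
          using trans rt by (auto simp: P_def)
        finally show "homotopic_paths X (\<tau> (p r) +++ subpath r t p) (\<tau> (p t))" .
      qed
    next
      case (local x)
      then have "p x \<in> X" using pX by auto
      then obtain W where W: "p x \<in> W" "W = U \<or> W = V" "openin (top_of_set X) W"
        using X opU opV by blast
      then obtain e where e: "e > 0" "\<And>y. y \<in> X \<Longrightarrow> dist y (p x) < e \<Longrightarrow> y \<in> W"
        unfolding openin_euclidean_subtopology_iff by metis
      obtain d where d: "d > 0" "\<And>t. t \<in> {0..1} \<Longrightarrow> dist t x < d \<Longrightarrow> dist (p t) (p x) < e"
        using p(1) local e(1) unfolding path_def continuous_on_iff by (metis atLeastAtMost_iff)
      have "P s t" if st: "s \<le> x" "x \<le> t" "t - s < d" for s t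
        unfolding P_def
      proof (intro impI)
        assume 01: "0 \<le> s" "t \<le> 1" "s \<le> t"
        have inW: "p u \<in> W" if "u \<in> {s..t}" for u
          using e(2) [of "p u"] d(2) [of u] pX [of u] st 01 that by (auto simp: dist_real_def)
        have sW: "path_image (subpath s t p) \<subseteq> W"
          using inW 01 by (auto simp: path_image_subpath)
        have X: "p s \<in> X" "p t \<in> X" using pX 01 by auto
        have "p s \<in> W" "p t \<in> W" using inW 01 by auto
        then have \<tau>W: "path_image (\<tau> (p s)) \<subseteq> W" "path_image (\<tau> (p t)) \<subseteq> W"
          using \<tau>(4,5) X W(2) by blast+
        show "homotopic_paths X (\<tau> (p s) +++ subpath s t p) (\<tau> (p t))"
          by (rule same_ends [OF _ _ _ _ _ W(2)])
            (use sW \<tau>W \<tau>(1-3) X p 01 in \<open>simp_all add: path_image_join\<close>)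
      qed
      then show ?case using d(1) by blast
    qed
    then show ?thesis by (simp add: P_def)
  qed
  have "homotopic_paths X p (linepath (pathstart p) (pathstart p))"
    if p: "path p" "path_image p \<subseteq> X" "pathfinish p = pathstart p" for p
  proof -
    let ?t = "\<tau> (pathstart p)"
    have sX: "pathstart p \<in> X" using p by blast
    have "homotopic_paths X (?t +++ p) ?t"
      using tails [OF p(1,2)] p(3) by (simp add: pathstart_def pathfinish_def)
    then have "homotopic_paths X (reversepath ?t +++ (?t +++ p)) (reversepath ?t +++ ?t)"
      using \<tau> \<tau>X sX by (intro homotopic_paths_join) auto
    moreover have "homotopic_paths X (reversepath ?t +++ (?t +++ p)) ((reversepath ?t +++ ?t) +++ p)"
      using \<tau> \<tau>X sX p by (intro homotopic_paths_assoc) auto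
    moreover have l: "homotopic_paths X (reversepath ?t +++ ?t) (linepath (pathstart p) (pathstart p))"
      using homotopic_paths_linv [of ?t X] \<tau> \<tau>X sX by auto
    moreover have "homotopic_paths X ((reversepath ?t +++ ?t) +++ p) (linepath (pathstart p) (pathstart p) +++ p)"
      using l \<tau> sX p by (intro homotopic_paths_join) auto
    moreover have "homotopic_paths X (linepath (pathstart p) (pathstart p) +++ p) p"
      using p by (intro homotopic_paths_lid) auto
    ultimately show ?thesis
      by (meson homotopic_paths_sym homotopic_paths_trans)
  qed
  moreover have "path_connected X"
    using path_connected_Un [OF pcU pcV ne] X by simp
  ultimately show ?thesis
    by (simp add: simply_connected_eq_contractible_path)
qed

section \<open>Loops, winding numbers and complements of graphs\<close>

lemma homotopic_loopsI:
  fixes h :: "real \<Rightarrow> real \<Rightarrow> 'a::topological_space"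
  assumes "continuous_on ({0..1} \<times> {0..1}) (\<lambda>x. h (fst x) (snd x))"
    and "\<And>s t. \<lbrakk>s \<in> {0..1}; t \<in> {0..1}\<rbrakk> \<Longrightarrow> h s t \<in> S"
    and "\<And>s. s \<in> {0..1} \<Longrightarrow> h s 1 = h s 0"
    and "\<And>t. t \<in> {0..1} \<Longrightarrow> h 0 t = p t" "\<And>t. t \<in> {0..1} \<Longrightarrow> h 1 t = q t"
  shows "homotopic_loops S p q"
  unfolding homotopic_loops
proof (rule exI [of _ "\<lambda>x. h (fst x) (snd x)"], intro conjI ballI)
qed (use assms in \<open>auto simp: pathstart_def pathfinish_def\<close>)

lemma winding_number_exp_path:
  assumes "path q" "\<And>t. t \<in> {0..1} \<Longrightarrow> p t = exp (q t)"
  shows "winding_number p 0 = (q 1 - q 0) / (2 * of_real pi * \<i>)"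
proof -
  have "winding_number p 0 = winding_number (exp \<circ> q) 0"
    by (rule winding_number_cong) (simp add: assms)
  then show ?thesis
    using winding_number_compose_exp [OF assms(1)] by (simp add: pathstart_def pathfinish_def)
qed

lemma winding_number_mult:
  assumes "path p" "path q" "0 \<notin> path_image p" "0 \<notin> path_image q"
  shows "winding_number (\<lambda>t. p t * q t) 0 = winding_number p 0 + winding_number q 0"
proof -
  obtain f where f: "path f" "pathfinish f - pathstart f = 2 * of_real pi * \<i> * winding_number p 0"
    "\<And>t. t \<in> {0..1} \<Longrightarrow> p t = exp (f t)"
    using winding_number_as_continuous_log [OF assms(1,3)] by auto
  obtain g where g: "path g" "pathfinish g - pathstart g = 2 * of_real pi * \<i> * winding_number q 0"
    "\<And>t. t \<in> {0..1} \<Longrightarrow> q t = exp (g t)"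
    using winding_number_as_continuous_log [OF assms(2,4)] by auto
  have "path (\<lambda>t. f t + g t)"
    using f(1) g(1) by (auto simp: path_def intro: continuous_intros)
  then have "winding_number (\<lambda>t. p t * q t) 0 = ((f 1 + g 1) - (f 0 + g 0)) / (2 * of_real pi * \<i>)"
    by (rule winding_number_exp_path) (simp add: f(3) g(3) exp_add)
  also have "\<dots> = ((f 1 - f 0) + (g 1 - g 0)) / (2 * of_real pi * \<i>)"
    by (simp add: algebra_simps)
  also have "\<dots> = winding_number p 0 + winding_number q 0"
    using f(2) g(2) by (simp add: pathstart_def pathfinish_def add_divide_distrib)
  finally show ?thesis .
qed

lemma winding_number_const:
  assumes "c \<noteq> 0"
  shows "winding_number (\<lambda>t. c) 0 = 0"
  using winding_number_exp_path [of "\<lambda>t. Ln c" "\<lambda>t. c"] assms by (simp add: path_def)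

lemma winding_number_cmult:
  assumes "path p" "0 \<notin> path_image p" "c \<noteq> 0"
  shows "winding_number (\<lambda>t. c * p t) 0 = winding_number p 0"
  using winding_number_mult [of "\<lambda>t. c" p] winding_number_const [of c] assms
  by (simp add: path_def path_image_def)

definition circle_loop :: "real \<Rightarrow> int \<Rightarrow> real \<Rightarrow> complex"
  where "circle_loop r n t = of_real r * exp (2 * of_real pi * \<i> * of_int n * of_real t)"

lemma continuous_on_circle_loop [continuous_intros]:
  "continuous_on S f \<Longrightarrow> continuous_on S (\<lambda>x. circle_loop r n (f x))"
  unfolding circle_loop_def by (intro continuous_intros)

lemma norm_circle_loop [simp]: "norm (circle_loop r n t) = \<bar>r\<bar>"
  by (simp add: circle_loop_def norm_mult)

lemma exp_2pi_int: "exp (2 * of_real pi * \<i> * of_int n) = (1::complex)"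
  using exp_integer_2pi [of "of_int n"] by (simp add: mult_ac)

lemma circle_loop_ends [simp]: "circle_loop r n 0 = of_real r" "circle_loop r n 1 = of_real r"
proof -
  show "circle_loop r n 1 = of_real r" by (simp add: circle_loop_def exp_2pi_int)
qed (simp add: circle_loop_def)

lemma winding_number_circle_loop:
  assumes "r > 0"
  shows "winding_number (circle_loop r n) 0 = of_int n"
proof -
  have "winding_number (circle_loop r n) 0
      = ((of_real (ln r) + 2 * of_real pi * \<i> * of_int n * of_real 1)
         - (of_real (ln r) + 2 * of_real pi * \<i> * of_int n * of_real 0)) / (2 * of_real pi * \<i>)"
    by (rule winding_number_exp_path)
      (use assms in \<open>auto simp: path_def circle_loop_def exp_add exp_of_real intro!: continuous_intros\<close>)
  then show ?thesis by simp
qed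

lemma winding_number_eq_homotopy:
  fixes h :: "real \<Rightarrow> real \<Rightarrow> complex"
  assumes "continuous_on ({0..1} \<times> {0..1}) (\<lambda>x. h (fst x) (snd x))"
    and "\<And>s t. \<lbrakk>s \<in> {0..1}; t \<in> {0..1}\<rbrakk> \<Longrightarrow> h s t \<noteq> 0"
    and "\<And>s. s \<in> {0..1} \<Longrightarrow> h s 1 = h s 0"
    and "\<And>t. t \<in> {0..1} \<Longrightarrow> h 0 t = p t" "\<And>t. t \<in> {0..1} \<Longrightarrow> h 1 t = q t"
  shows "winding_number p 0 = winding_number q 0"
  by (rule winding_number_homotopic_loops, rule homotopic_loopsI [of h]) (use assms in auto)

lemma winding_number_offset_circle:
  assumes "0 < r" "r < \<bar>c\<bar>"
  shows "winding_number (\<lambda>t. of_real c + circle_loop r n t) 0 = 0"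
proof -
  have "winding_number (\<lambda>t. of_real c + circle_loop r n t) 0 = winding_number (\<lambda>t. of_real c * circle_loop 1 0 t) 0"
  proof (rule winding_number_eq_homotopy [where h = "\<lambda>s t. of_real c + of_real (1 - s) * circle_loop r n t"])
    fix s t :: real assume "s \<in> {0..1}"
    then have "norm (of_real (1 - s) * circle_loop r n t) \<le> r"
      using assms by (simp add: norm_mult mult_left_le_one_le del: of_real_diff)
    then show "of_real c + of_real (1 - s) * circle_loop r n t \<noteq> 0"
      using assms by (metis add_eq_0_iff norm_minus_cancel norm_of_real not_less)
  qed (auto intro!: continuous_intros simp: circle_loop_def [of 1 0])
  also have "\<dots> = winding_number (circle_loop 1 0) 0"
    using assms by (intro winding_number_cmult) (auto simp: path_def path_image_def circle_loop_def [of 1 0] intro!: continuous_intros)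
  finally show ?thesis by (simp add: winding_number_circle_loop)
qed

text \<open>A perturbation parameter that is harmless at \<open>0\<close> is harmless at some positive value, uniformly over
  a compact set.\<close>

lemma nonvanishing_tube:
  fixes g :: "real \<times> 'a::heine_borel \<Rightarrow> complex"
  assumes g: "continuous_on ({0..d} \<times> K) g" and K: "compact K" and d: "d > 0"
    and nz: "\<And>k. k \<in> K \<Longrightarrow> g (0, k) \<noteq> 0"
  obtains e where "0 < e" "e \<le> d" "\<And>k. k \<in> K \<Longrightarrow> g (e, k) \<noteq> 0"
proof -
  define Z where "Z = ({0..d} \<times> K) \<inter> g -` {0}"
  have cd: "compact ({0..d} \<times> K)"
    by (simp add: compact_Times K)
  have "closed Z"
    unfolding Z_def by (rule continuous_closed_preimage [OF g]) (use cd compact_imp_closed in auto)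
  then have "compact Z"
    using compact_Int_closed [OF cd] by (metis Z_def inf.left_idem)
  then have "closed (fst ` Z)"
    by (intro compact_imp_closed compact_continuous_image continuous_intros)
  moreover have "0 \<notin> fst ` Z"
    using nz by (auto simp: Z_def)
  ultimately obtain e where e: "e > 0" "ball 0 e \<subseteq> - fst ` Z"
    by (metis Compl_iff open_Compl openE)
  define e' where "e' = min (e/2) d"
  have "e' \<in> ball 0 e" "0 < e'" "e' \<le> d"
    using e d by (auto simp: e'_def min_def)
  moreover have "g (e', k) \<noteq> 0" if "k \<in> K" for k
  proof
    assume "g (e', k) = 0"
    then have "(e', k) \<in> Z"
      using that calculation by (simp add: Z_def)
    then have "e' \<in> fst ` Z" by force
    then show False using calculation(1) e(2) by blast
  qed
  ultimately show ?thesis using that by blast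
qed

abbreviation power_graph_complement :: "nat \<Rightarrow> complex set \<Rightarrow> (complex \<times> complex) set"
  where "power_graph_complement k A \<equiv> {(\<zeta>, v). \<zeta> \<in> A \<and> v ^ k \<noteq> \<zeta>}"

text \<open>The complement of the graph \<open>\<zeta> = v\<^sup>k\<close> over a star-shaped \<open>A\<close> has the homotopy type of a circle, via
  \<open>\<zeta> - v\<^sup>k\<close>. On all of \<open>\<complex> \<times> \<complex>\<close> one would contract \<open>v\<close> with \<open>\<zeta> - v\<^sup>k\<close> held fixed, but that may move
  \<open>\<zeta>\<close> out of \<open>A\<close>. The weighted scaling \<open>(s\<^sup>k \<zeta>, s v)\<close> first makes room.\<close>

lemma loop_in_power_graph_complement:
  assumes k: "k > 0" and star: "\<And>\<zeta> s. \<lbrakk>\<zeta> \<in> A; 0 \<le> s; s \<le> 1\<rbrakk> \<Longrightarrow> of_real s * \<zeta> \<in> A"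
    and \<delta>: "\<delta> > 0" "ball 0 \<delta> \<subseteq> A"
    and P: "path P" "path_image P \<subseteq> power_graph_complement k A" "pathfinish P = pathstart P"
    and n: "winding_number (\<lambda>t. fst (P t) - snd (P t) ^ k) 0 = of_int n"
  shows "homotopic_loops (power_graph_complement k A) P (\<lambda>t. (circle_loop (\<delta>/2) n t, 0))"
proof -
  let ?W = "power_graph_complement k A"
  define \<zeta> v where "\<zeta> = (\<lambda>t. fst (P t))" and "v = (\<lambda>t. snd (P t))"
  have P_eq: "P t = (\<zeta> t, v t)" for t by (simp add: \<zeta>_def v_def)
  have cP: "continuous_on {0..1} P" using P by (simp add: path_def)
  have c\<zeta>: "continuous_on {0..1} \<zeta>" and cv: "continuous_on {0..1} v"
    unfolding \<zeta>_def v_def by (intro continuous_intros cP)+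
  have c\<zeta>': "continuous_on ({0..1} \<times> {0..1}) (\<lambda>x. \<zeta> (snd x))"
    and cv': "continuous_on ({0..1} \<times> {0..1}) (\<lambda>x. v (snd x))"
    by (rule continuous_on_compose2 [OF c\<zeta>] continuous_on_compose2 [OF cv]; auto intro!: continuous_intros)+
  have ends: "\<zeta> 1 = \<zeta> 0" "v 1 = v 0"
    using P(3) by (auto simp: \<zeta>_def v_def pathstart_def pathfinish_def)
  have W: "\<zeta> t \<in> A" "v t ^ k \<noteq> \<zeta> t" "\<zeta> t \<noteq> v t ^ k" if "t \<in> {0..1}" for t
    using subsetD [OF P(2), of "P t"] that by (auto simp: path_image_def P_eq)
  have "bounded (\<zeta> ` {0..1})" "bounded ((\<lambda>t. v t ^ k) ` {0..1})"
    by (intro compact_imp_bounded compact_continuous_image continuous_intros c\<zeta> cv; simp)+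
  then obtain M1 M2 where M12: "\<And>t. t \<in> {0..1} \<Longrightarrow> norm (\<zeta> t) \<le> M1" "\<And>t. t \<in> {0..1} \<Longrightarrow> norm (v t ^ k) \<le> M2"
    unfolding bounded_iff by blast
  define M where "M = max M1 M2 + 1"
  have M: "norm (\<zeta> t) \<le> M" "norm (v t ^ k) \<le> M" if "t \<in> {0..1}" for t
    using M12 [OF that] by (auto simp: M_def)
  have Mpos: "M > 0"
    using M12(1) [of 0] order_trans [OF norm_ge_zero [of "\<zeta> 0"]] by (force simp: M_def)
  define s where "s = min 1 (\<delta> / (6 * M))"
  have s: "0 < s" "s \<le> 1" "s * (6 * M) \<le> \<delta>"
    using Mpos \<delta>(1) by (auto simp: s_def min_def field_simps)
  have sk: "0 < s ^ k" "s ^ k \<le> s" "s ^ k \<le> 1"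
    using s k power_decreasing [of 1 k s] by (auto simp: power_le_one)
  have skM: "s ^ k * (6 * M) \<le> \<delta>"
    using sk(2) s(3) Mpos by (meson less_eq_real_def mult_right_mono order_trans zero_less_mult_iff zero_less_numeral)
  define u where "u = (\<lambda>t. of_real (s ^ k) * (\<zeta> t - v t ^ k))"
  have u0: "u t \<noteq> 0" if "t \<in> {0..1}" for t
    using W(2) [OF that] s(1) by (simp add: u_def)
  have unorm: "norm (u t) \<le> s ^ k * (2 * M)" if "t \<in> {0..1}" for t
  proof -
    have "norm (\<zeta> t - v t ^ k) \<le> 2 * M"
      using M [OF that] norm_triangle_ineq4 [of "\<zeta> t" "v t ^ k"] by linarith
    then show ?thesis
      using s(1) by (simp add: u_def norm_mult norm_power)
  qed
  have cu: "continuous_on {0..1} u"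
    unfolding u_def by (intro continuous_intros c\<zeta> cv)
  have cu': "continuous_on ({0..1} \<times> {0..1}) (\<lambda>x. u (snd x))"
    by (rule continuous_on_compose2 [OF cu]; auto intro!: continuous_intros)
  have uends: "u 1 = u 0"
    by (simp add: u_def ends)
  have H1: "homotopic_loops ?W P (\<lambda>t. (of_real (s ^ k) * \<zeta> t, of_real s * v t))"
  proof (rule homotopic_loopsI [where h = "\<lambda>\<tau> t. (of_real ((1 - \<tau> + \<tau> * s) ^ k) * \<zeta> t, of_real (1 - \<tau> + \<tau> * s) * v t)"])
    fix \<tau> t :: real assume \<tau>: "\<tau> \<in> {0..1}" and t: "t \<in> {0..1}"
    let ?r = "1 - \<tau> + \<tau> * s"
    have "(1 - \<tau>) + \<tau> * s > 0"
      using \<tau> s(1) by (cases "\<tau> = 1") (auto intro!: add_pos_nonneg)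
    moreover have "\<tau> * s \<le> \<tau> * 1"
      using \<tau> s(2) by (intro mult_left_mono) auto
    ultimately have r: "0 < ?r" "?r \<le> 1" by auto
    have "of_real (?r ^ k) * \<zeta> t \<in> A"
      using star [OF W(1) [OF t], of "?r ^ k"] r by (simp add: power_le_one)
    moreover have "(of_real ?r * v t) ^ k \<noteq> of_real (?r ^ k) * \<zeta> t"
    proof -
      have "complex_of_real ?r ^ k \<noteq> 0"
        using r(1) by (metis of_real_eq_0_iff less_irrefl power_not_zero)
      then show ?thesis
        using W(2) [OF t] by (simp only: power_mult_distrib of_real_power mult_cancel_left) simp
    qed
    ultimately show "(of_real (?r ^ k) * \<zeta> t, of_real ?r * v t) \<in> ?W"
      by blast
  qed (auto simp: P_eq ends intro!: continuous_intros c\<zeta>' cv')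
  \<comment> \<open>contract the fibre variable, with the value of the defining function held fixed\<close>
  have H2: "homotopic_loops ?W (\<lambda>t. (of_real (s ^ k) * \<zeta> t, of_real s * v t)) (\<lambda>t. (u t, 0))"
  proof (rule homotopic_loopsI [where h = "\<lambda>\<tau> t. (u t + (of_real ((1 - \<tau>) * s) * v t) ^ k, of_real ((1 - \<tau>) * s) * v t)"])
    fix \<tau> t :: real assume \<tau>: "\<tau> \<in> {0..1}" and t: "t \<in> {0..1}"
    have "norm ((of_real ((1 - \<tau>) * s) * v t) ^ k) = (1 - \<tau>) ^ k * (s ^ k * norm (v t ^ k))"
      using \<tau> s(1) by (simp add: norm_mult norm_power power_mult_distrib abs_mult del: of_real_mult of_real_diff)
    also have "\<dots> \<le> 1 * (s ^ k * M)"
      using \<tau> s(1) M(2) [OF t] by (intro mult_mono) (auto simp: power_le_one)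
    finally have "norm (u t + (of_real ((1 - \<tau>) * s) * v t) ^ k) \<le> s ^ k * (2 * M) + 1 * (s ^ k * M)"
      by (rule norm_triangle_mono [OF unorm [OF t]])
    also have "\<dots> < \<delta>"
      using skM mult_pos_pos [OF sk(1) Mpos] by linarith
    finally have "u t + (of_real ((1 - \<tau>) * s) * v t) ^ k \<in> A"
      using \<delta>(2) by (auto simp: dist_norm)
    then show "(u t + (of_real ((1 - \<tau>) * s) * v t) ^ k, of_real ((1 - \<tau>) * s) * v t) \<in> ?W"
      using u0 [OF t] by auto
  next
    fix t :: real
    show "(u t + (of_real ((1 - 0) * s) * v t) ^ k, of_real ((1 - 0) * s) * v t) = (of_real (s ^ k) * \<zeta> t, of_real s * v t)"
      by (simp add: u_def algebra_simps power_mult_distrib)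
  qed (use k in \<open>auto simp: ends uends intro!: continuous_intros cv' cu'\<close>)
  have pu: "path u" "0 \<notin> path_image u"
    using cu u0 by (auto simp: path_def path_image_def)
  have wu: "winding_number u 0 = of_int n"
  proof -
    have c: "path (\<lambda>t. \<zeta> t - v t ^ k)" "0 \<notin> path_image (\<lambda>t. \<zeta> t - v t ^ k)"
      using W(3) by (auto simp: path_def path_image_def intro!: continuous_intros c\<zeta> cv)
    have e: "winding_number (\<lambda>t. of_real (s ^ k)) 0 = 0"
    proof -
      have "circle_loop (s ^ k) 0 = (\<lambda>t. of_real (s ^ k))"
        by (simp add: circle_loop_def fun_eq_iff)
      then show ?thesis
        using winding_number_circle_loop [of "s ^ k" 0] sk(1) by simp
    qed
    have "winding_number u 0 = winding_number (\<lambda>t. of_real (s ^ k)) 0 + winding_number (\<lambda>t. \<zeta> t - v t ^ k) 0"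
      unfolding u_def by (rule winding_number_mult) (use c s(1) in \<open>auto simp: path_def path_image_def\<close>)
    then show ?thesis
      using n e by (simp add: \<zeta>_def v_def)
  qed
  obtain q where q: "path q" "pathfinish q - pathstart q = 2 * of_real pi * \<i> * of_int n"
    "\<And>t. t \<in> {0..1} \<Longrightarrow> u t = exp (q t)"
    using winding_number_as_continuous_log [OF pu] wu by auto
  have q1: "q 1 = q 0 + 2 * of_real pi * \<i> * of_int n"
    using q(2) by (simp add: pathstart_def pathfinish_def algebra_simps)
  have cq': "continuous_on ({0..1} \<times> {0..1}) (\<lambda>x. q (snd x))"
    by (rule continuous_on_compose2 [of "{0..1}" q]) (use q(1) in \<open>auto simp: path_def intro!: continuous_intros\<close>)
  \<comment> \<open>interpolate the logarithms; this never increases the modulus beyond the larger of the two\<close>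
  have H3: "homotopic_loops ?W (\<lambda>t. (u t, 0)) (\<lambda>t. (circle_loop (\<delta>/2) n t, 0))"
  proof (rule homotopic_loopsI [where h = "\<lambda>\<tau> t. (exp (of_real (1 - \<tau>) * q t
          + of_real \<tau> * (of_real (ln (\<delta>/2)) + 2 * of_real pi * \<i> * of_int n * of_real t)), 0)"])
    fix \<tau> t :: real assume \<tau>: "\<tau> \<in> {0..1}" and t: "t \<in> {0..1}"
    let ?L = "of_real (1 - \<tau>) * q t + of_real \<tau> * (of_real (ln (\<delta>/2)) + 2 * of_real pi * \<i> * of_int n * of_real t)"
    have "norm (u t) \<le> \<delta> / 2"
      using unorm [OF t] skM mult_pos_pos [OF sk(1) Mpos] by linarith
    then have "exp (Re (q t)) \<le> \<delta> / 2"
      by (simp add: q(3) [OF t])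
    then have "Re (q t) \<le> ln (\<delta> / 2)"
      using \<delta>(1) by (metis exp_gt_zero exp_le_cancel_iff exp_ln half_gt_zero)
    then have "(1 - \<tau>) * Re (q t) + \<tau> * ln (\<delta>/2) \<le> (1 - \<tau>) * ln (\<delta>/2) + \<tau> * ln (\<delta>/2)"
      using \<tau> by (intro add_mono mult_left_mono) auto
    then have "Re ?L \<le> ln (\<delta>/2)"
      by (simp add: algebra_simps)
    then have "exp (Re ?L) \<le> \<delta>/2"
      using \<delta>(1) by (metis exp_le_cancel_iff exp_ln half_gt_zero)
    then have "norm (exp ?L) < \<delta>"
      using \<delta>(1) by (simp del: Re_complex_of_real)
    then show "(exp ?L, 0) \<in> ?W"
      using \<delta>(2) k by (auto simp: dist_norm power_0_left simp del: norm_exp_eq_Re)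
  next
    fix \<tau> :: real
    have "of_real (1 - \<tau>) * q 1 + of_real \<tau> * (of_real (ln (\<delta>/2)) + 2 * of_real pi * \<i> * of_int n * of_real 1)
       = (of_real (1 - \<tau>) * q 0 + of_real \<tau> * (of_real (ln (\<delta>/2)) + 2 * of_real pi * \<i> * of_int n * of_real 0))
        + 2 * of_real pi * \<i> * of_int n"
      by (simp add: q1 algebra_simps)
    moreover have "exp (2 * of_real pi * \<i> * of_int n) = 1"
      by (rule exp_2pi_int)
    ultimately show "(exp (of_real (1 - \<tau>) * q 1 + of_real \<tau> * (of_real (ln (\<delta>/2)) + 2 * of_real pi * \<i> * of_int n * of_real 1)), 0)
      = (exp (of_real (1 - \<tau>) * q 0 + of_real \<tau> * (of_real (ln (\<delta>/2)) + 2 * of_real pi * \<i> * of_int n * of_real 0)), 0)"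
      by (simp only: exp_add) simp
  next
    fix t :: real
    show "(exp (of_real (1 - 1) * q t + of_real 1 * (of_real (ln (\<delta>/2)) + 2 * of_real pi * \<i> * of_int n * of_real t)), 0)
       = (circle_loop (\<delta>/2) n t, 0)"
      using \<delta>(1) by (simp add: circle_loop_def exp_add exp_of_real)
  qed (auto simp: q(3) intro!: continuous_intros cq')
  show ?thesis
    using H1 H2 H3 homotopic_loops_trans by blast
qed

section \<open>The base of the surface and loops over one side\<close>

definition depth :: "complex \<Rightarrow> real"
  where "depth z = max 0 (4 * \<bar>Re z\<bar> - 1)"

text \<open>The branching parameter of the sheets, a function of the base point. It is \<open>1\<close> on the strip
  \<open>\<bar>Re z\<bar> \<le> 1/4\<close>, and on either side of it an embedding into the half-plane \<open>Re \<zeta> < 1\<close> that hits \<open>0\<close> at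
  \<open>\<plusminus>1/2\<close>. Collapsing the boundary line of the side to the point \<open>1\<close> is what makes the sheets constant
  on the strip.\<close>

definition base_map :: "complex \<Rightarrow> complex"
  where "base_map z = 1 - of_real (depth z) * (1 + \<i> * of_real (Im z))"

text \<open>The inverse of \<open>base_map\<close> on the left side \<open>Re z < -1/4\<close>.\<close>

definition chart :: "complex \<Rightarrow> complex"
  where "chart \<zeta> = Complex (- (2 - Re \<zeta>) / 4) (- Im \<zeta> / (1 - Re \<zeta>))"

definition chart_domain :: "complex set"
  where "chart_domain = {\<zeta>. Re \<zeta> < 1 \<and> norm (chart \<zeta>) < 1}"

lemma depth_nonneg [simp]: "0 \<le> depth z"
  by (simp add: depth_def)

lemma continuous_on_depth [continuous_intros]:
  "continuous_on S f \<Longrightarrow> continuous_on S (\<lambda>x. depth (f x))"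
  unfolding depth_def by (intro continuous_intros)

lemma continuous_on_base_map [continuous_intros]:
  "continuous_on S f \<Longrightarrow> continuous_on S (\<lambda>x. base_map (f x))"
  unfolding base_map_def by (intro continuous_intros)

lemma continuous_on_chart: "continuous_on {\<zeta>. Re \<zeta> < 1} chart"
  unfolding chart_def by (intro continuous_on_Complex continuous_intros) auto

lemma Re_base_map: "Re (base_map z) = 1 - depth z" and Im_base_map: "Im (base_map z) = - depth z * Im z"
  by (simp_all add: base_map_def)

lemma chart_base_map: "Re z < -1/4 \<Longrightarrow> chart (base_map z) = z"
  by (simp add: chart_def complex_eq_iff Re_base_map Im_base_map depth_def field_simps)

lemma depth_chart: "Re \<zeta> < 1 \<Longrightarrow> depth (chart \<zeta>) = 1 - Re \<zeta>"
  by (simp add: chart_def depth_def)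

lemma base_map_chart: "Re \<zeta> < 1 \<Longrightarrow> base_map (chart \<zeta>) = \<zeta>"
  by (simp add: complex_eq_iff Re_base_map Im_base_map depth_chart) (simp add: chart_def field_simps)

lemma Re_chart: "Re \<zeta> < 1 \<Longrightarrow> Re (chart \<zeta>) < -1/4"
  by (simp add: chart_def)

lemma open_chart_domain: "open chart_domain"
proof -
  have eq: "chart_domain = {\<zeta>. Re \<zeta> < 1} \<inter> chart -` ball 0 1"
    by (auto simp: chart_domain_def)
  show ?thesis
    unfolding eq by (rule continuous_open_preimage [OF continuous_on_chart open_halfspace_Re_lt open_ball])
qed

lemma zero_in_chart_domain: "0 \<in> chart_domain"
  by (simp add: chart_domain_def chart_def cmod_def power2_eq_square)

text \<open>In terms of the depth \<open>t\<close> and \<open>y = Im z\<close>, scaling \<open>\<zeta>\<close> by \<open>s\<close> leads from \<open>(t, y)\<close> to \<open>(t', s t y / t')\<close>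
  with \<open>t' = (1 - s) + s t\<close>. For \<open>t \<ge> 1\<close> both \<open>t\<close> and \<open>\<bar>y\<bar>\<close> decrease. For \<open>t < 1\<close> the factor of \<open>y\<close> is at most
  \<open>s\<close>, so that the point stays inside the convex hull of \<open>(1, 0)\<close> and \<open>(t, \<plusminus>y)\<close>.\<close>

lemma chart_domain_star:
  assumes \<zeta>: "\<zeta> \<in> chart_domain" and s: "0 \<le> s" "s \<le> 1"
  shows "of_real s * \<zeta> \<in> chart_domain"
proof -
  define t y where "t = 1 - Re \<zeta>" and "y = - Im \<zeta> / t"
  define t' y' where "t' = 1 - s * Re \<zeta>" and "y' = - (s * Im \<zeta>) / t'"
  have t: "t > 0" and n: "((1 + t) / 4)\<^sup>2 + y\<^sup>2 < 1"
    using \<zeta> by (auto simp: chart_domain_def chart_def t_def y_def cmod_def real_sqrt_lt_1_iff power_divide power2_commute)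
  have t'_eq: "t' = (1 - s) + s * t"
    by (simp add: t'_def t_def algebra_simps)
  have t': "t' > 0"
    using t s unfolding t'_eq by (cases "s = 1") (auto intro: add_pos_nonneg)
  have Im\<zeta>: "Im \<zeta> = - (y * t)"
    using t by (simp add: y_def)
  have y'_eq: "y' = (s * t / t') * y"
    by (simp add: y'_def Im\<zeta>)
  have "((1 + t') / 4)\<^sup>2 + y'\<^sup>2 < 1"
  proof (cases "t \<ge> 1")
    case True
    have "t' \<le> t"
      using True s mult_left_mono [of 1 t "1 - s"] by (simp add: t'_eq algebra_simps)
    moreover have "s * t / t' \<le> 1"
      using s t' by (simp add: t'_eq)
    then have "\<bar>y'\<bar> \<le> \<bar>y\<bar>"
      using s t t' unfolding y'_eq abs_mult by (intro mult_left_le_one_le) auto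
    ultimately have "((1 + t') / 4)\<^sup>2 \<le> ((1 + t) / 4)\<^sup>2" "y'\<^sup>2 \<le> y\<^sup>2"
      using t' by (auto simp: abs_le_square_iff intro!: power_mono)
    then show ?thesis using n by linarith
  next
    case False
    have "s * (1 - t) \<le> 1 - t"
      using False s by (intro mult_left_le_one_le) auto
    then have "t \<le> t'"
      by (simp add: t'_eq algebra_simps)
    then have "s * t / t' \<le> s"
      using s t' by (simp add: divide_le_eq mult_left_mono)
    then have "\<bar>y'\<bar> \<le> s * \<bar>y\<bar>"
      using s t t' unfolding y'_eq abs_mult by (intro mult_right_mono) auto
    then have "y'\<^sup>2 \<le> (s * y)\<^sup>2"
      using s by (metis abs_ge_zero abs_mult abs_of_nonneg abs_le_square_iff)
    moreover have "(Complex ((1 + t') / 4) (s * y)) = of_real (1 - s) * Complex (1/2) 0 + of_real s * Complex ((1 + t) / 4) y"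
      by (simp add: complex_eq_iff t'_eq field_simps)
    then have "norm (Complex ((1 + t') / 4) (s * y)) \<le> (1 - s) * (1/2) + s * norm (Complex ((1 + t) / 4) y)"
      using s by (metis (no_types, lifting) abs_of_nonneg complex_norm complex_of_real_def diff_ge_0_iff_ge
          half_gt_zero_iff norm_mult norm_of_real norm_triangle_ineq order_less_imp_le zero_less_one)
    moreover have "norm (Complex ((1 + t) / 4) y) < 1"
      using n by (simp add: cmod_def)
    then have "(1 - s) * (1/2) + s * norm (Complex ((1 + t) / 4) y) < 1"
    proof (cases "s = 1")
      case False
      assume "norm (Complex ((1 + t) / 4) y) < 1"
      then have "s * norm (Complex ((1 + t) / 4) y) \<le> s"
        using s by (intro mult_left_le) auto
      moreover have "(1 - s) * (1/2) < 1 - s" using s False by simp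
      ultimately show ?thesis by linarith
    qed simp
    ultimately have "norm (Complex ((1 + t') / 4) (s * y)) < 1" by linarith
    then have "((1 + t') / 4)\<^sup>2 + (s * y)\<^sup>2 < 1"
      by (simp add: cmod_def)
    then show ?thesis using \<open>y'\<^sup>2 \<le> (s * y)\<^sup>2\<close> by linarith
  qed
  then show ?thesis
    using t' by (simp add: chart_domain_def chart_def t'_def y'_def cmod_def power2_commute power_divide)
qed

text \<open>Over the strip the cubic sheets touch, so loops must be moved off it before the chart applies. The
  points with \<open>Re z > -1/4 - e\<close> move towards the centre \<open>-1/2\<close> of the left side, which keeps them in
  the disc, and for \<open>s = 1\<close> they arrive at \<open>Re z = -1/4 - e\<close>. The fibre variable does not move; for \<open>e = 0\<close>
  this is harmless because the sheets over the strip are constant.\<close>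

definition push :: "real \<Rightarrow> real \<Rightarrow> complex \<Rightarrow> complex"
  where "push e s z = z + of_real (s * (max 0 (Re z + 1/4 + e) / (max 0 (Re z + 1/4 + e) + (1/4 - e)))) * (- 1/2 - z)"

lemma continuous_on_push [continuous_intros]:
  assumes "continuous_on S e" "continuous_on S s" "continuous_on S z" "\<And>x. x \<in> S \<Longrightarrow> e x < 1/4"
  shows "continuous_on S (\<lambda>x. push (e x) (s x) (z x))"
proof -
  have "max 0 (Re (z x) + 1/4 + e x) + (1/4 - e x) \<noteq> 0" if "x \<in> S" for x
    using assms(4) [OF that] by (simp add: max_def)
  then show ?thesis
    unfolding push_def by (intro continuous_intros assms) auto
qed

lemma push_0 [simp]: "push e 0 z = z"
  by (simp add: push_def)

lemma push_in_region:
  assumes e: "0 \<le> e" "e < 1/4" and s: "0 \<le> s" "s \<le> 1" and z: "norm z < 1" "Re z < 1/4"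
  shows "norm (push e s z) < 1" "Re (push e s z) < 1/4"
proof -
  define m where "m = max 0 (Re z + 1/4 + e)"
  define a where "a = s * (m / (m + (1/4 - e)))"
  have m: "m \<ge> 0" by (simp add: m_def)
  have "m / (m + (1/4 - e)) < 1" "0 \<le> m / (m + (1/4 - e))"
    using m e by (auto simp: divide_simps)
  then have a: "0 \<le> a" "a < 1"
    using s mult_left_le_one_le [of "m / (m + (1/4 - e))" s] unfolding a_def
    by (metis mult_nonneg_nonneg, linarith)
  have "push e s z = z + of_real a * (- 1/2 - z)"
    by (simp only: push_def a_def m_def)
  then have p: "push e s z = of_real (1 - a) * z + of_real a * (- 1/2)"
    by (simp add: algebra_simps)
  have "norm (push e s z) \<le> (1 - a) * norm z + a * (1/2)"
    unfolding p using a by (intro norm_triangle_le) (simp add: norm_mult del: of_real_diff)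
  also have "\<dots> < 1"
  proof -
    have "(1 - a) * norm z < 1 - a"
      using a z(1) mult_strict_left_mono [of "norm z" 1 "1 - a"] by simp
    then show ?thesis using a by linarith
  qed
  finally show "norm (push e s z) < 1" .
  have "Re (push e s z) = (1 - a) * Re z + a * (- 1/2)"
    by (simp add: p)
  also have "\<dots> < (1 - a) * (1/4) + a * (1/4)"
    using z(2) a by (intro add_less_le_mono mult_strict_left_mono mult_left_mono) auto
  also have "\<dots> = 1/4" by (simp add: field_simps)
  finally show "Re (push e s z) < 1/4" .
qed

lemma Re_push:
  assumes "e < 1/4" "Re z + 1/4 + e \<ge> 0"
  shows "Re (push e s z) = Re z - s * (Re z + 1/4 + e)"
proof -
  have "Re z + 1/2 > 0" using assms by linarith
  then show ?thesis
    using assms by (simp add: push_def max_def field_simps)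
qed

lemma push_1:
  assumes "0 < e" "e < 1/4"
  shows "Re (push e 1 z) < -1/4"
proof (cases "Re z + 1/4 + e \<ge> 0")
  case True then show ?thesis using Re_push [of e z 1] assms by simp
next
  case False then show ?thesis using assms by (simp add: push_def max_def)
qed

lemma push_collar:
  assumes "0 \<le> s" "s \<le> 1" "Re z < 1/4"
  shows "depth (push 0 s z) = depth z" "base_map (push 0 s z) = base_map z"
proof -
  have "push 0 s z = z \<or> depth (push 0 s z) = 0 \<and> depth z = 0"
  proof (cases "Re z + 1/4 \<ge> 0")
    case True
    have r: "Re (push 0 s z) = Re z - s * (Re z + 1/4)"
      using Re_push [of 0 z s] True by simp
    have "s * (Re z + 1/4) \<le> Re z + 1/4" "0 \<le> s * (Re z + 1/4)"
      using True assms by (auto intro!: mult_left_le_one_le)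
    then have "\<bar>Re (push 0 s z)\<bar> \<le> 1/4" "\<bar>Re z\<bar> \<le> 1/4"
      using r True assms(3) by linarith+
    then show ?thesis by (simp add: depth_def)
  next
    case False then show ?thesis by (simp add: push_def max_def)
  qed
  then show "depth (push 0 s z) = depth z" "base_map (push 0 s z) = base_map z"
    by (auto simp: base_map_def)
qed

text \<open>One side of the surface, with \<open>k\<close> sheets, placed over the left part of the disc. The function
  \<open>f t \<zeta> w\<close> is the polynomial in \<open>w\<close> that defines the sheets at depth \<open>t\<close> and branching parameter \<open>\<zeta>\<close>.
  At positive depth, \<open>\<Lambda> t\<close> straightens these sheets to the \<open>k\<close>-th roots of \<open>\<zeta>\<close>. At depth \<open>0\<close> only \<open>f\<close> has
  to make sense, so that sheets may collide there.\<close>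

locale fibred_side =
  fixes k :: nat and f :: "real \<Rightarrow> complex \<Rightarrow> complex \<Rightarrow> complex"
    and \<Lambda> \<Lambda>' :: "real \<Rightarrow> complex \<Rightarrow> complex"
  assumes k: "k > 0"
    and cf: "continuous_on ({0..} \<times> UNIV \<times> UNIV) (\<lambda>x. f (fst x) (fst (snd x)) (snd (snd x)))"
    and c\<Lambda>: "continuous_on ({0<..} \<times> UNIV) (\<lambda>x. \<Lambda> (fst x) (snd x))"
    and c\<Lambda>': "continuous_on ({0<..} \<times> UNIV) (\<lambda>x. \<Lambda>' (fst x) (snd x))"
    and \<Lambda>: "\<And>t w. t > 0 \<Longrightarrow> \<Lambda> t (\<Lambda>' t w) = w"
    and zero: "\<And>t \<zeta> v. t > 0 \<Longrightarrow> f t \<zeta> (\<Lambda> t v) = 0 \<longleftrightarrow> v ^ k = \<zeta>"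
    and wind: "\<And>\<tau> \<zeta> v. \<lbrakk>path \<tau>; path \<zeta>; path v; \<tau> 1 = \<tau> 0; \<zeta> 1 = \<zeta> 0; v 1 = v 0;
        \<And>x. x \<in> {0..1} \<Longrightarrow> \<tau> x > 0 \<and> v x ^ k \<noteq> \<zeta> x\<rbrakk>
        \<Longrightarrow> winding_number (\<lambda>x. f (\<tau> x) (\<zeta> x) (\<Lambda> (\<tau> x) (v x))) 0 = winding_number (\<lambda>x. \<zeta> x - v x ^ k) 0"
begin

definition F :: "complex \<times> complex \<Rightarrow> complex"
  where "F x = f (depth (fst x)) (base_map (fst x)) (snd x)"

definition region :: "(complex \<times> complex) set"
  where "region = {x. norm (fst x) < 1 \<and> Re (fst x) < 1/4 \<and> F x \<noteq> 0}"

lemma continuous_on_f: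
  assumes "continuous_on S a" "continuous_on S b" "continuous_on S c" "\<And>x. x \<in> S \<Longrightarrow> 0 \<le> a x"
  shows "continuous_on S (\<lambda>x. f (a x) (b x) (c x))"
  by (rule continuous_on_compose2 [OF cf, of S "\<lambda>x. (a x, b x, c x)", simplified])
    (use assms in \<open>auto intro!: continuous_intros\<close>)

lemma continuous_on_F: "continuous_on S F"
  unfolding F_def by (intro continuous_on_f continuous_intros) auto

text \<open>The loop is pushed off the strip, where the chart and \<open>\<Lambda>\<close> identify the complement of the sheets with
  the complement of the graph \<open>\<zeta> = v\<^sup>k\<close>.\<close>

lemma canonical_loop:
  assumes p: "path p" "path_image p \<subseteq> region" "pathfinish p = pathstart p"
    and n: "winding_number (F \<circ> p) 0 = of_int n"
    and \<delta>: "\<delta> > 0" "ball 0 \<delta> \<subseteq> chart_domain"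
  shows "homotopic_loops region p (\<lambda>x. (chart (circle_loop (\<delta>/2) n x), \<Lambda> (1 - Re (circle_loop (\<delta>/2) n x)) 0))"
proof -
  define z w where "z = (\<lambda>t. fst (p t))" and "w = (\<lambda>t. snd (p t))"
  have cp: "continuous_on {0..1} p" using p by (simp add: path_def)
  have cz: "continuous_on {0..1} z" and cw: "continuous_on {0..1} w"
    unfolding z_def w_def by (intro continuous_intros cp)+
  have ends: "z 1 = z 0" "w 1 = w 0"
    using p(3) by (auto simp: z_def w_def pathstart_def pathfinish_def)
  have inr: "norm (z t) < 1" "Re (z t) < 1/4" "f (depth (z t)) (base_map (z t)) (w t) \<noteq> 0" if "t \<in> {0..1}" for t
    using subsetD [OF p(2), of "p t"] that by (auto simp: path_image_def region_def F_def z_def w_def)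
  \<comment> \<open>by compactness some positive push meets no sheet, as the push with parameter 0 meets none\<close>
  define g where "g = (\<lambda>x::real \<times> (real \<times> real). f (depth (push (fst x) (fst (snd x)) (z (snd (snd x)))))
      (base_map (push (fst x) (fst (snd x)) (z (snd (snd x))))) (w (snd (snd x))))"
  have cg: "continuous_on ({0..1/8} \<times> ({0..1} \<times> {0..1})) g"
    unfolding g_def
    by (intro continuous_on_f continuous_intros continuous_on_compose2 [OF cz] continuous_on_compose2 [OF cw]) auto
  have "compact ({0..1::real} \<times> {0..1::real})"
    by (simp add: compact_Times)
  moreover have "g (0, x) \<noteq> 0" if "x \<in> {0..1} \<times> {0..1}" for x
    using that inr [of "snd x"] push_collar [of "fst x" "z (snd x)"] by (auto simp: g_def)
  ultimately obtain e where e: "0 < e" "e \<le> 1/8" "\<And>x. x \<in> {0..1} \<times> {0..1} \<Longrightarrow> g (e, x) \<noteq> 0"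
    using nonvanishing_tube [OF cg] by (metis zero_less_divide_1_iff zero_less_numeral)
  define z' where "z' = (\<lambda>t. push e 1 (z t))"
  have H1: "homotopic_loops region p (\<lambda>t. (z' t, w t))"
  proof (rule homotopic_loopsI [where h = "\<lambda>s t. (push e s (z t), w t)"])
    show "continuous_on ({0..1} \<times> {0..1}) (\<lambda>x. (push e (fst x) (z (snd x)), w (snd x)))"
      using e by (intro continuous_intros continuous_on_compose2 [OF cz] continuous_on_compose2 [OF cw]) auto
  next
    fix s t :: real assume st: "s \<in> {0..1}" "t \<in> {0..1}"
    show "(push e s (z t), w t) \<in> region"
      using push_in_region [of e s "z t"] inr [OF st(2)] e(1,2) e(3) [of "(s, t)"] st
      by (auto simp: region_def F_def g_def)
  next
    show "(push e 0 (z t), w t) = p t" for t by (simp add: z_def w_def)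
  qed (simp_all add: ends z'_def)
  have cz': "continuous_on {0..1} z'"
    unfolding z'_def using e by (intro continuous_intros cz) auto
  have ends': "z' 1 = z' 0" by (simp add: z'_def ends)
  have Rez': "Re (z' t) < - 1/4" for t
    using push_1 e by (auto simp: z'_def)
  have z'D: "depth (z' t) > 0" for t
    using Rez' [of t] by (simp add: depth_def)
  have inr': "(z' t, w t) \<in> region" if "t \<in> {0..1}" for t
    using homotopic_loops_imp_subset [OF H1] that by (auto simp: path_image_def)
  define \<zeta> where "\<zeta> = (\<lambda>t. base_map (z' t))"
  define v where "v = (\<lambda>t. \<Lambda>' (depth (z' t)) (w t))"
  have c\<zeta>: "continuous_on {0..1} \<zeta>"
    unfolding \<zeta>_def by (intro continuous_intros cz')
  have cv: "continuous_on {0..1} v"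
    unfolding v_def
    by (rule continuous_on_compose2 [OF c\<Lambda>', of "{0..1}" "\<lambda>t. (depth (z' t), w t)", simplified])
      (use z'D in \<open>auto intro!: continuous_intros cz' cw\<close>)
  have \<Lambda>v: "\<Lambda> (depth (z' t)) (v t) = w t" for t
    using \<Lambda> z'D by (simp add: v_def)
  have chart\<zeta>: "chart (\<zeta> t) = z' t" and Re\<zeta>: "1 - Re (\<zeta> t) = depth (z' t)" for t
    using chart_base_map Rez' by (auto simp: \<zeta>_def Re_base_map)
  have vk: "v t ^ k \<noteq> \<zeta> t" if "t \<in> {0..1}" for t
    using inr' [OF that] zero [OF z'D, of t "\<zeta> t" "v t"] \<Lambda>v by (auto simp: region_def F_def \<zeta>_def)
  have \<zeta>A: "\<zeta> t \<in> chart_domain" if "t \<in> {0..1}" for t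
    using inr' [OF that] chart\<zeta> Re\<zeta> [of t] z'D [of t] by (auto simp: chart_domain_def region_def)
  have "winding_number (\<lambda>t. \<zeta> t - v t ^ k) 0 = winding_number (\<lambda>t. f (depth (z' t)) (\<zeta> t) (\<Lambda> (depth (z' t)) (v t))) 0"
    by (rule wind [symmetric])
      (use vk z'D in \<open>auto simp: path_def \<zeta>_def v_def ends' ends intro!: continuous_intros cz' c\<zeta> [unfolded \<zeta>_def] cv [unfolded v_def]\<close>)
  also have "\<dots> = winding_number (F \<circ> (\<lambda>t. (z' t, w t))) 0"
    by (simp add: \<Lambda>v F_def o_def \<zeta>_def)
  also have "\<dots> = winding_number (F \<circ> p) 0"
    by (rule winding_number_homotopic_loops [symmetric], rule homotopic_loops_continuous_image [OF H1 continuous_on_F])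
      (auto simp: region_def)
  finally have wn: "winding_number (\<lambda>t. \<zeta> t - v t ^ k) 0 = of_int n"
    using n by simp
  define \<Theta> where "\<Theta> = (\<lambda>x. (chart (fst x), \<Lambda> (1 - Re (fst x)) (snd x)))"
  have "homotopic_loops (power_graph_complement k chart_domain) (\<lambda>t. (\<zeta> t, v t)) (\<lambda>t. (circle_loop (\<delta>/2) n t, 0))"
    by (rule loop_in_power_graph_complement [OF k chart_domain_star \<delta>])
      (use vk \<zeta>A wn in \<open>auto simp: path_def path_image_def pathstart_def pathfinish_def \<zeta>_def v_def ends' ends
          intro!: continuous_intros c\<zeta> [unfolded \<zeta>_def] cv [unfolded v_def]\<close>)
  then have "homotopic_loops region (\<Theta> \<circ> (\<lambda>t. (\<zeta> t, v t))) (\<Theta> \<circ> (\<lambda>t. (circle_loop (\<delta>/2) n t, 0)))"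
  proof (rule homotopic_loops_continuous_image)
    show "continuous_on (power_graph_complement k chart_domain) \<Theta>"
      unfolding \<Theta>_def
      by (intro continuous_on_Pair continuous_on_compose2 [OF continuous_on_chart]
          continuous_on_compose2 [OF c\<Lambda>, of _ "\<lambda>x. (1 - Re (fst x), snd x)", simplified] continuous_intros)
        (auto simp: chart_domain_def)
    show "\<Theta> \<in> power_graph_complement k chart_domain \<rightarrow> region"
    proof
      fix x assume "x \<in> power_graph_complement k chart_domain"
      then have "Re (fst x) < 1" "norm (chart (fst x)) < 1" "snd x ^ k \<noteq> fst x"
        by (auto simp: chart_domain_def)
      then show "\<Theta> x \<in> region"
        using zero [of "1 - Re (fst x)" "fst x" "snd x"] Re_chart [of "fst x"]
        by (simp add: \<Theta>_def region_def F_def depth_chart base_map_chart)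
    qed

  qed
  moreover have "\<Theta> \<circ> (\<lambda>t. (\<zeta> t, v t)) = (\<lambda>t. (z' t, w t))"
    by (simp add: \<Theta>_def fun_eq_iff chart\<zeta> Re\<zeta> \<Lambda>v)
  ultimately have "homotopic_loops region (\<lambda>t. (z' t, w t)) (\<lambda>x. (chart (circle_loop (\<delta>/2) n x), \<Lambda> (1 - Re (circle_loop (\<delta>/2) n x)) 0))"
    by (simp add: \<Theta>_def o_def)
  then show ?thesis
    using H1 homotopic_loops_trans by blast
qed

proposition loops_classified_by_winding:
  assumes p: "path p" "path_image p \<subseteq> region" "pathfinish p = pathstart p"
    and q: "path q" "path_image q \<subseteq> region" "pathfinish q = pathstart q"
    and eq: "winding_number (F \<circ> p) 0 = winding_number (F \<circ> q) 0"
  shows "homotopic_loops region p q"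
proof -
  obtain \<delta> where \<delta>: "\<delta> > 0" "ball 0 \<delta> \<subseteq> chart_domain"
    using open_chart_domain zero_in_chart_domain openE by blast
  have "winding_number (F \<circ> p) 0 \<in> \<int>"
    using p path_continuous_image [OF p(1) continuous_on_F]
    by (intro integer_winding_number) (auto simp: path_image_def pathstart_def pathfinish_def region_def)
  then obtain n where "winding_number (F \<circ> p) 0 = of_int n"
    using Ints_cases by blast
  then have "homotopic_loops region p (\<lambda>x. (chart (circle_loop (\<delta>/2) n x), \<Lambda> (1 - Re (circle_loop (\<delta>/2) n x)) 0))"
    and "homotopic_loops region q (\<lambda>x. (chart (circle_loop (\<delta>/2) n x), \<Lambda> (1 - Re (circle_loop (\<delta>/2) n x)) 0))"
    using canonical_loop [OF p _ \<delta>] canonical_loop [OF q _ \<delta>] eq by auto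
  then show ?thesis
    by (rule homotopic_loops_trans [OF _ homotopic_loops_sym])
qed

end

section \<open>The quadratic and the cubic sheets\<close>

text \<open>Its roots are \<open>w = (1 + 3 v) / 4\<close> with \<open>v\<^sup>2 = \<zeta>\<close>, normalised so that \<open>\<zeta> = 1\<close> gives \<open>1\<close> and \<open>-1/2\<close>.\<close>

definition quadratic_side :: "real \<Rightarrow> complex \<Rightarrow> complex \<Rightarrow> complex"
  where "quadratic_side t \<zeta> w = (w - 1/4)\<^sup>2 - 9/16 * \<zeta>"

text \<open>The monic cubic with the roots \<open>p v + q v\<^sup>*\<close>, where \<open>v\<close> runs through the cube roots of \<open>\<zeta>\<close> and \<open>v\<^sup>*\<close>
  is the conjugate of \<open>v\<close>: with \<open>a = p v\<close> and \<open>b = q v\<^sup>*\<close> it is \<open>w\<^sup>3 - 3 a b w - (a\<^sup>3 + b\<^sup>3)\<close>, as in Cardano's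
  formula. The cube root in the linear coefficient is \<open>\<bar>v\<bar>\<^sup>2\<close>.\<close>

definition cardano :: "real \<Rightarrow> real \<Rightarrow> complex \<Rightarrow> complex \<Rightarrow> complex"
  where "cardano p q \<zeta> w = w ^ 3 - 3 * of_real (p * q * root 3 ((cmod \<zeta>)\<^sup>2)) * w
           - (of_real (p ^ 3) * \<zeta> + of_real (q ^ 3) * cnj \<zeta>)"

text \<open>Since \<open>(1 + t)/2 v + (1 - t)/2 v\<^sup>* = Re v + \<i> t Im v\<close>, the imaginary parts of the cube roots of \<open>\<zeta>\<close> are
  multiplied by the depth \<open>t\<close>. At \<open>t = 0\<close> and \<open>\<zeta> = 1\<close> the two non-real cube roots of \<open>1\<close> meet at \<open>-1/2\<close>.\<close>

definition cubic_side :: "real \<Rightarrow> complex \<Rightarrow> complex \<Rightarrow> complex"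
  where "cubic_side t = cardano ((1 + t) / 2) ((1 - t) / 2)"

lemma continuous_on_cardano:
  assumes "continuous_on S p" "continuous_on S q" "continuous_on S z" "continuous_on S w"
  shows "continuous_on S (\<lambda>x. cardano (p x) (q x) (z x) (w x))"
  unfolding cardano_def by (intro continuous_intros assms)

lemma cube_factor:
  fixes W a b u :: complex
  assumes "u\<^sup>2 + u + 1 = 0"
  shows "W ^ 3 - 3 * (a * b) * W - (a ^ 3 + b ^ 3) = (W - (a + b)) * (W - (u * a + u\<^sup>2 * b)) * (W - (u\<^sup>2 * a + u * b))"
proof -
  have u2: "u\<^sup>2 = - 1 - u" using assms by (simp add: eq_neg_iff_add_eq_0 algebra_simps)
  then have uu: "u * u = - 1 - u" "u * (u * x) = - x - u * x" for x
    by (simp_all add: power2_eq_square left_diff_distrib flip: mult.assoc)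
  show ?thesis
    unfolding u2 by (simp add: power3_eq_cube algebra_simps uu)
qed

lemma real_linear_combination_eq_0:
  assumes "\<bar>q\<bar> < p"
  shows "of_real p * d + of_real q * cnj d = 0 \<longleftrightarrow> d = 0"
proof
  assume "of_real p * d + of_real q * cnj d = 0"
  then have "norm (of_real p * d) = norm (of_real q * cnj d)"
    by (metis add_eq_0_iff norm_minus_cancel)
  then have "\<bar>p\<bar> * norm d = \<bar>q\<bar> * norm d"
    by (simp add: norm_mult)
  then show "d = 0" using assms by auto
qed simp

lemma cardano_eq_0_iff:
  assumes "\<bar>q\<bar> < p"
  shows "cardano p q \<zeta> (of_real p * v + of_real q * cnj v) = 0 \<longleftrightarrow> v ^ 3 = \<zeta>"
proof -
  obtain r where r: "r ^ 3 = \<zeta>"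
    by (metis exists_complex_root zero_neq_numeral)
  define u where "u = Complex (-1/2) (sqrt 3 / 2)"
  have u: "u\<^sup>2 + u + 1 = 0" and cu: "cnj u = u\<^sup>2" and cu2: "cnj (u\<^sup>2) = u"
    by (simp_all add: u_def complex_eq_iff power2_eq_square)
  let ?L = "\<lambda>x. of_real p * x + of_real q * cnj x"
  have root: "root 3 ((cmod \<zeta>)\<^sup>2) = (cmod r)\<^sup>2"
  proof -
    have "(cmod \<zeta>)\<^sup>2 = ((cmod r)\<^sup>2) ^ 3"
      by (simp add: r [symmetric] norm_power flip: power_mult)
    then have "root 3 ((cmod \<zeta>)\<^sup>2) = root 3 (((cmod r)\<^sup>2) ^ 3)"
      by (simp only:)
    also have "\<dots> = (cmod r)\<^sup>2"
      by (rule real_root_power_cancel) auto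
    finally show ?thesis .
  qed
  have eq: "cardano p q \<zeta> W = (W - ?L r) * (W - ?L (u * r)) * (W - ?L (u\<^sup>2 * r))" for W
  proof -
    have "(of_real p * r) * (of_real q * cnj r) = of_real (p * q) * (r * cnj r)"
      by simp
    also have "\<dots> = of_real (p * q * root 3 ((cmod \<zeta>)\<^sup>2))"
      by (simp only: root complex_norm_square [symmetric] of_real_mult)
    finally have "(of_real p * r) * (of_real q * cnj r) = of_real (p * q * root 3 ((cmod \<zeta>)\<^sup>2))" .
    moreover have "(of_real p * r) ^ 3 + (of_real q * cnj r) ^ 3 = of_real (p ^ 3) * \<zeta> + of_real (q ^ 3) * cnj \<zeta>"
      by (simp add: r [symmetric] power_mult_distrib)
    ultimately have "cardano p q \<zeta> W = W ^ 3 - 3 * ((of_real p * r) * (of_real q * cnj r)) * W - ((of_real p * r) ^ 3 + (of_real q * cnj r) ^ 3)"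
      unfolding cardano_def by (simp only: mult.assoc of_real_mult)
    also have "\<dots> = (W - ?L r) * (W - (u * (of_real p * r) + u\<^sup>2 * (of_real q * cnj r))) * (W - (u\<^sup>2 * (of_real p * r) + u * (of_real q * cnj r)))"
      by (rule cube_factor [OF u])
    also have "u * (of_real p * r) + u\<^sup>2 * (of_real q * cnj r) = ?L (u * r)"
      by (simp only: complex_cnj_mult cu) (simp add: mult_ac)
    also have "u\<^sup>2 * (of_real p * r) + u * (of_real q * cnj r) = ?L (u\<^sup>2 * r)"
      by (simp only: complex_cnj_mult cu2) (simp add: mult_ac)
    finally show ?thesis .
  qed
  have inj: "?L v - ?L x = 0 \<longleftrightarrow> v = x" for x
    using real_linear_combination_eq_0 [OF assms, of "v - x"] by (simp add: algebra_simps)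
  have "cardano p q \<zeta> (?L v) = 0 \<longleftrightarrow> v = r \<or> v = u * r \<or> v = u\<^sup>2 * r"
    unfolding eq mult_eq_0_iff inj by blast
  moreover have "v ^ 3 - r ^ 3 = (v - r) * (v - u * r) * (v - u\<^sup>2 * r)"
    using cube_factor [OF u, of v r 0] by (simp add: mult.commute mult.left_commute)
  ultimately show ?thesis
    using r by (metis mult_eq_0_iff right_minus_eq)
qed

definition stretch :: "real \<Rightarrow> complex \<Rightarrow> complex"
  where "stretch t v = of_real ((1 + t) / 2) * v + of_real ((1 - t) / 2) * cnj v"

lemma stretch_inverse:
  "t > 0 \<Longrightarrow> stretch t (Complex (Re w) (Im w / t)) = w"
  by (simp add: stretch_def complex_eq_iff field_simps)

interpretation right: fibred_side 2 quadratic_side "\<lambda>t v. (1 + 3 * v) / 4" "\<lambda>t w. (4 * w - 1) / 3"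
proof
  show "continuous_on ({0..} \<times> UNIV \<times> UNIV) (\<lambda>x. quadratic_side (fst x) (fst (snd x)) (snd (snd x)))"
    unfolding quadratic_side_def by (intro continuous_intros)
  have eq: "quadratic_side t \<zeta> ((1 + 3 * v) / 4) = (- 9/16) * (\<zeta> - v ^ 2)" for t \<zeta> v
    by (simp add: quadratic_side_def power2_eq_square field_simps)
  show "quadratic_side t \<zeta> ((1 + 3 * v) / 4) = 0 \<longleftrightarrow> v\<^sup>2 = \<zeta>" for t \<zeta> v
    unfolding eq by auto
  show "winding_number (\<lambda>x. quadratic_side (\<tau> x) (\<zeta> x) ((1 + 3 * v x) / 4)) 0 = winding_number (\<lambda>x. \<zeta> x - (v x)\<^sup>2) 0"
    if "path \<zeta>" "path v" "\<And>x. x \<in> {0..1} \<Longrightarrow> \<tau> x > 0 \<and> (v x)\<^sup>2 \<noteq> \<zeta> x" for \<tau> \<zeta> v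
    unfolding eq using that
    by (intro winding_number_cmult) (auto simp: path_def path_image_def intro!: continuous_intros, metis)
  show "(1 + 3 * ((4 * w - 1) / 3)) / 4 = w" for w :: complex
    by (simp add: field_simps)
qed (auto intro!: continuous_intros)

interpretation left: fibred_side 3 cubic_side stretch "\<lambda>t w. Complex (Re w) (Im w / t)"
proof
  show "continuous_on ({0..} \<times> UNIV \<times> UNIV) (\<lambda>x. cubic_side (fst x) (fst (snd x)) (snd (snd x)))"
    unfolding cubic_side_def by (intro continuous_on_cardano continuous_intros) auto
  show "continuous_on ({0<..} \<times> UNIV) (\<lambda>x. stretch (fst x) (snd x))"
    unfolding stretch_def by (intro continuous_intros) auto
  show "continuous_on ({0<..} \<times> UNIV) (\<lambda>x. Complex (Re (snd x)) (Im (snd x) / fst x))"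
    by (intro continuous_on_Complex continuous_intros) auto
  have pq: "\<bar>(1 - t) / 2\<bar> < (1 + t) / 2" if "t > 0" for t :: real
    using that unfolding abs_less_iff by (simp add: field_simps)
  show "cubic_side t \<zeta> (stretch t v) = 0 \<longleftrightarrow> v ^ 3 = \<zeta>" if "t > 0" for t \<zeta> v
    unfolding cubic_side_def stretch_def by (rule cardano_eq_0_iff [OF pq [OF that]])
  show "winding_number (\<lambda>x. cubic_side (\<tau> x) (\<zeta> x) (stretch (\<tau> x) (v x))) 0 = winding_number (\<lambda>x. \<zeta> x - v x ^ 3) 0"
    if pa: "path \<tau>" "path \<zeta>" "path v" and ends: "\<tau> 1 = \<tau> 0" "\<zeta> 1 = \<zeta> 0" "v 1 = v 0"
      and nz: "\<And>x. x \<in> {0..1} \<Longrightarrow> \<tau> x > 0 \<and> v x ^ 3 \<noteq> \<zeta> x" for \<tau> \<zeta> v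
  proof -
    \<comment> \<open>deform the distortion to the identity through real-linear isomorphisms, under which the zeros correspond to the cube roots throughout\<close>
    define P Q where "P = (\<lambda>s x. (1 - s) * ((1 + \<tau> x) / 2) + s)" and "Q = (\<lambda>s x. (1 - s) * ((1 - \<tau> x) / 2))"
    note c = pa [unfolded path_def]
    have cs: "continuous_on ({0..1} \<times> {0..1}) (\<lambda>x::real\<times>real. \<tau> (snd x))" "continuous_on ({0..1} \<times> {0..1}) (\<lambda>x::real\<times>real. \<zeta> (snd x))"
      "continuous_on ({0..1} \<times> {0..1}) (\<lambda>x::real\<times>real. v (snd x))"
      by (rule continuous_on_compose2 [OF c(1)] continuous_on_compose2 [OF c(2)] continuous_on_compose2 [OF c(3)];
          auto intro!: continuous_intros)+
    have "winding_number (\<lambda>x. cubic_side (\<tau> x) (\<zeta> x) (stretch (\<tau> x) (v x))) 0 = winding_number (\<lambda>x. (-1) * (\<zeta> x - v x ^ 3)) 0"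
    proof (rule winding_number_eq_homotopy [where h = "\<lambda>s x. cardano (P s x) (Q s x) (\<zeta> x) (of_real (P s x) * v x + of_real (Q s x) * cnj (v x))"])
      show "continuous_on ({0..1} \<times> {0..1}) (\<lambda>x. cardano (P (fst x) (snd x)) (Q (fst x) (snd x)) (\<zeta> (snd x))
         (of_real (P (fst x) (snd x)) * v (snd x) + of_real (Q (fst x) (snd x)) * cnj (v (snd x))))"
        unfolding P_def Q_def by (intro continuous_on_cardano continuous_intros cs) auto
    next
      fix s x :: real assume s: "s \<in> {0..1}" and x: "x \<in> {0..1}"
      have "\<bar>Q s x\<bar> < P s x"
      proof (cases "s = 1")
        case False
        then have "(1 - s) * \<bar>(1 - \<tau> x) / 2\<bar> < (1 - s) * ((1 + \<tau> x) / 2)"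
          using s nz [OF x] pq by (intro mult_strict_left_mono) auto
        moreover have "\<bar>Q s x\<bar> = (1 - s) * \<bar>(1 - \<tau> x) / 2\<bar>"
          using s by (simp add: Q_def abs_mult)
        ultimately show ?thesis
          using s unfolding P_def by simp
      qed (simp add: P_def Q_def)
      then show "cardano (P s x) (Q s x) (\<zeta> x) (of_real (P s x) * v x + of_real (Q s x) * cnj (v x)) \<noteq> 0"
        using nz [OF x] by (simp add: cardano_eq_0_iff)
    next
      show "cardano (P s 1) (Q s 1) (\<zeta> 1) (of_real (P s 1) * v 1 + of_real (Q s 1) * cnj (v 1))
          = cardano (P s 0) (Q s 0) (\<zeta> 0) (of_real (P s 0) * v 0 + of_real (Q s 0) * cnj (v 0))" for s
        by (simp add: P_def Q_def ends)
    next
      show "cardano (P 0 x) (Q 0 x) (\<zeta> x) (of_real (P 0 x) * v x + of_real (Q 0 x) * cnj (v x))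
          = cubic_side (\<tau> x) (\<zeta> x) (stretch (\<tau> x) (v x))" for x
        by (simp add: P_def Q_def cubic_side_def stretch_def)
    next
      show "cardano (P 1 x) (Q 1 x) (\<zeta> x) (of_real (P 1 x) * v x + of_real (Q 1 x) * cnj (v x))
          = (-1) * (\<zeta> x - v x ^ 3)" for x
        by (simp add: P_def Q_def cardano_def)
    qed
    also have "\<dots> = winding_number (\<lambda>x. \<zeta> x - v x ^ 3) 0"
      using nz by (intro winding_number_cmult) (auto simp: path_def path_image_def intro!: continuous_intros c, metis)
    finally show ?thesis .
  qed
qed (auto simp: stretch_inverse)

section \<open>The pinched surface and Hausdorff continuity\<close>

lemma power_le_prod_mset:
  fixes g :: "'a \<Rightarrow> real"
  assumes "0 \<le> c" "\<And>x. x \<in># A \<Longrightarrow> c \<le> g x"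
  shows "c ^ size A \<le> (\<Prod>x\<in>#A. g x)"
  using assms(2)
proof (induction A)
  case (add x A)
  have "c * c ^ size A \<le> g x * (\<Prod>x\<in>#A. g x)"
    using add assms(1) by (intro mult_mono) (auto intro: order_trans)
  then show ?case by simp
qed simp

text \<open>The modulus of \<open>P w0\<close> is the product of the distances of \<open>w0\<close> to the roots, so the nearest root does it.\<close>

lemma monic_root_near:
  fixes P :: "complex poly"
  assumes "lead_coeff P = 1" "degree P > 0"
  obtains w where "poly P w = 0" "norm (w - w0) ^ degree P \<le> norm (poly P w0)"
proof -
  let ?A = "proots P"
  let ?g = "\<lambda>x. norm (x - w0)"
  have P0: "P \<noteq> 0" using assms by auto
  have size: "size ?A = degree P" by (rule size_proots_complex)
  then have ne: "set_mset ?A \<noteq> {}" using assms(2) by auto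
  have dec: "P = (\<Prod>x\<in>#?A. [:-x, 1:])"
    using complex_poly_decompose_multiset [of P] assms(1) by simp
  have prod: "poly (\<Prod>x\<in>#M. [:-x, 1:]) w0 = (\<Prod>x\<in>#M. w0 - x)" for M
    by (induction M) (auto simp: algebra_simps)
  have normprod: "norm (\<Prod>x\<in>#M. w0 - x) = (\<Prod>x\<in>#M. ?g x)" for M
    by (induction M) (auto simp: norm_mult norm_minus_commute)
  have "Min (?g ` set_mset ?A) \<in> ?g ` set_mset ?A"
    using ne by (intro Min_in) auto
  then obtain w where w: "w \<in># ?A" "?g w = Min (?g ` set_mset ?A)" by auto
  have "?g w ^ size ?A \<le> (\<Prod>x\<in>#?A. ?g x)"
  proof (rule power_le_prod_mset)
    show "?g w \<le> ?g x" if "x \<in># ?A" for x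
      using that unfolding w(2) by (intro Min_le) auto
  qed simp
  also have "\<dots> = norm (poly P w0)"
    using dec prod normprod by metis
  finally have "?g w ^ degree P \<le> norm (poly P w0)"
    by (simp add: size)
  moreover have "poly P w = 0"
    using w(1) P0 by simp
  ultimately show ?thesis using that by blast
qed

lemma excess_bounds:
  fixes A B :: "complex set"
  assumes "finite A" "A \<noteq> {}" "finite B" "B \<noteq> {}" and e: "\<And>b. b \<in> B \<Longrightarrow> \<exists>a\<in>A. dist b a < e"
  shows "0 \<le> (SUP b\<in>B. INF a\<in>A. cmod (a - b))" "(SUP b\<in>B. INF a\<in>A. cmod (a - b)) \<le> e"
proof -
  have nn: "0 \<le> (INF a\<in>A. cmod (a - b))" for b
    using assms(2) by (intro cINF_greatest) auto
  obtain b where b: "b \<in> B" using assms(4) by blast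
  have "(INF a\<in>A. cmod (a - b)) \<le> (SUP b\<in>B. INF a\<in>A. cmod (a - b))"
    using b assms(3) by (intro cSUP_upper) auto
  then show "0 \<le> (SUP b\<in>B. INF a\<in>A. cmod (a - b))"
    using nn [of b] by linarith
  have "(INF a\<in>A. cmod (a - b)) \<le> e" if b: "b \<in> B" for b
  proof -
    obtain a where a: "a \<in> A" "dist b a < e" using e [OF b] by blast
    then have "(INF a\<in>A. cmod (a - b)) \<le> cmod (a - b)"
      using assms(1) by (intro cINF_lower) auto
    then show ?thesis using a(2) by (simp add: dist_norm norm_minus_commute)
  qed
  then show "(SUP b\<in>B. INF a\<in>A. cmod (a - b)) \<le> e"
    using assms(4) by (intro cSUP_least)
qed

text \<open>Compactness of the total space gives the upper half of Hausdorff continuity. Only the lower half,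
  that every point of a fibre is approached by nearby fibres, is left to the hypothesis.\<close>

lemma hausdorff_continuous_onI:
  assumes E: "compact E" and fin: "\<And>z. z \<in> D \<Longrightarrow> finite (fiber E z)" and ne: "\<And>z. z \<in> D \<Longrightarrow> fiber E z \<noteq> {}"
    and lsc: "\<And>z0 w0 e. \<lbrakk>z0 \<in> D; w0 \<in> fiber E z0; e > 0\<rbrakk>
       \<Longrightarrow> \<forall>\<^sub>F z in at z0 within D. \<exists>w\<in>fiber E z. dist w0 w < e"
  shows "hausdorff_continuous_on D (fiber E)"
  unfolding hausdorff_continuous_on_def
proof (intro allI impI)
  fix z :: "nat \<Rightarrow> complex" and z0
  assume zD: "\<forall>j. z j \<in> D" and z0: "z0 \<in> D" and lim: "z \<longlonglongrightarrow> z0"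
  have near: "\<forall>\<^sub>F j in sequentially. (\<forall>w0\<in>fiber E z0. \<exists>w\<in>fiber E (z j). dist w0 w < e)
         \<and> (\<forall>w\<in>fiber E (z j). \<exists>w0\<in>fiber E z0. dist w w0 < e)" if e: "e > 0" for e
  proof (rule eventually_conj)
    have "\<forall>\<^sub>F j in sequentially. \<exists>w\<in>fiber E (z j). dist w0 w < e" if w0: "w0 \<in> fiber E z0" for w0
    proof -
      have "\<forall>\<^sub>F y in at z0 within D. \<exists>w\<in>fiber E y. dist w0 w < e"
        using lsc [OF z0 w0 e] .
      then obtain d where d: "d > 0" "\<And>y. y \<in> D \<Longrightarrow> y \<noteq> z0 \<Longrightarrow> dist y z0 < d \<Longrightarrow> \<exists>w\<in>fiber E y. dist w0 w < e"
        unfolding eventually_at by blast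
      have "\<forall>\<^sub>F j in sequentially. dist (z j) z0 < d"
        using lim d(1) by (rule tendstoD)
      then show ?thesis
      proof (rule eventually_mono)
        fix j assume "dist (z j) z0 < d"
        then show "\<exists>w\<in>fiber E (z j). dist w0 w < e"
          using d(2) [of "z j"] zD w0 e by (cases "z j = z0") (auto intro: bexI [of _ w0])
      qed
    qed
    then show "\<forall>\<^sub>F j in sequentially. \<forall>w0\<in>fiber E z0. \<exists>w\<in>fiber E (z j). dist w0 w < e"
      using fin [OF z0] by (simp add: eventually_ball_finite)
  next
    define C where "C = E \<inter> {x. \<forall>w0\<in>fiber E z0. e \<le> dist (snd x) w0}"
    have "{x::complex\<times>complex. \<forall>w0\<in>fiber E z0. e \<le> dist (snd x) w0} = (\<Inter>w0\<in>fiber E z0. {x. e \<le> dist (snd x) w0})"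
      by auto
    also have "closed \<dots>"
      by (intro closed_INT ballI closed_Collect_le continuous_intros)
    finally have "compact C"
      unfolding C_def using E by (rule compact_Int_closed [rotated])
    then have "closed (fst ` C)"
      by (intro compact_imp_closed compact_continuous_image continuous_intros)
    moreover have "z0 \<notin> fst ` C"
      using e by (auto simp: C_def fiber_def)
    ultimately have "\<forall>\<^sub>F j in sequentially. z j \<in> - fst ` C"
      using lim by (intro topological_tendstoD) auto
    then show "\<forall>\<^sub>F j in sequentially. \<forall>w\<in>fiber E (z j). \<exists>w0\<in>fiber E z0. dist w w0 < e"
    proof (rule eventually_mono)
      fix j assume j: "z j \<in> - fst ` C"
      show "\<forall>w\<in>fiber E (z j). \<exists>w0\<in>fiber E z0. dist w w0 < e"
      proof (rule ballI, rule ccontr)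
        fix w assume w: "w \<in> fiber E (z j)" and "\<not> (\<exists>w0\<in>fiber E z0. dist w w0 < e)"
        then have "(z j, w) \<in> C"
          by (auto simp: C_def fiber_def not_less)
        then show False using j by force
      qed
    qed
  qed
  show "(\<lambda>j. hausdorff_distance (fiber E (z j)) (fiber E z0)) \<longlonglongrightarrow> 0"
  proof (rule tendstoI)
    fix e :: real assume "e > 0"
    then have "\<forall>\<^sub>F j in sequentially. (\<forall>w0\<in>fiber E z0. \<exists>w\<in>fiber E (z j). dist w0 w < e/3)
         \<and> (\<forall>w\<in>fiber E (z j). \<exists>w0\<in>fiber E z0. dist w w0 < e/3)"
      by (intro near) auto
    then show "\<forall>\<^sub>F j in sequentially. dist (hausdorff_distance (fiber E (z j)) (fiber E z0)) 0 < e"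
    proof (rule eventually_mono)
      fix j assume j: "(\<forall>w0\<in>fiber E z0. \<exists>w\<in>fiber E (z j). dist w0 w < e/3)
         \<and> (\<forall>w\<in>fiber E (z j). \<exists>w0\<in>fiber E z0. dist w w0 < e/3)"
      have zj: "z j \<in> D" using zD by blast
      note f = fin [OF zj] ne [OF zj] fin [OF z0] ne [OF z0]
      show "dist (hausdorff_distance (fiber E (z j)) (fiber E z0)) 0 < e"
        using excess_bounds [OF f(1,2) f(3,4), of "e/3"] excess_bounds [OF f(3,4) f(1,2), of "e/3"] j \<open>e > 0\<close>
        unfolding hausdorff_distance_def dist_real_def by force
    qed
  qed
qed

text \<open>The definition switches polynomials at \<open>Re z = 0\<close>, in the middle of the strip where both have the same
  zeros. So the cubic defines the surface for \<open>Re z < 1/4\<close> and the quadratic for \<open>Re z > -1/4\<close>.\<close>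

definition pinched_surface :: "(complex \<times> complex) set"
  where "pinched_surface = {x. norm (fst x) \<le> 1 \<and> (if Re (fst x) \<le> 0 then left.F x = 0 else right.F x = 0)}"

lemma sheets_over_collar:
  assumes "\<bar>Re z\<bar> \<le> 1/4"
  shows "left.F (z, w) = (w - 1) * (w + 1/2)\<^sup>2" "right.F (z, w) = (w - 1) * (w + 1/2)"
proof -
  have d: "depth z = 0" using assms by (simp add: depth_def)
  then have b: "base_map z = 1" by (simp add: base_map_def)
  show "left.F (z, w) = (w - 1) * (w + 1/2)\<^sup>2"
    by (simp add: left.F_def d b cubic_side_def cardano_def power2_eq_square power3_eq_cube field_simps)
  show "right.F (z, w) = (w - 1) * (w + 1/2)"
    by (simp add: right.F_def d b quadratic_side_def power2_eq_square field_simps)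
qed

lemma pinched_surface_left:
  assumes "norm z \<le> 1" "Re z < 1/4"
  shows "(z, w) \<in> pinched_surface \<longleftrightarrow> left.F (z, w) = 0"
  using assms sheets_over_collar [of z w] by (auto simp: pinched_surface_def)

lemma pinched_surface_right:
  assumes "norm z \<le> 1" "- 1/4 < Re z"
  shows "(z, w) \<in> pinched_surface \<longleftrightarrow> right.F (z, w) = 0"
  using assms sheets_over_collar [of z w] by (auto simp: pinched_surface_def)

definition cubic_poly :: "complex \<Rightarrow> complex poly"
  where "cubic_poly z = (let p = (1 + depth z) / 2; q = (1 - depth z) / 2 in
   [: - (of_real (p ^ 3) * base_map z + of_real (q ^ 3) * cnj (base_map z)),
      - (3 * of_real (p * q * root 3 ((cmod (base_map z))\<^sup>2))), 0, 1:])"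

definition quadratic_poly :: "complex \<Rightarrow> complex poly"
  where "quadratic_poly z = [: 1/16 - 9/16 * base_map z, - 1/2, 1:]"

lemma poly_cubic_poly: "poly (cubic_poly z) w = left.F (z, w)"
proof -
  have "poly [:- A, - B, 0, 1:] w = w ^ 3 - B * w - A" for A B
    by (simp add: power3_eq_cube algebra_simps)
  then show ?thesis
    by (simp only: cubic_poly_def left.F_def cubic_side_def cardano_def Let_def fst_conv snd_conv)
qed

lemma poly_quadratic_poly: "poly (quadratic_poly z) w = right.F (z, w)"
  by (simp add: quadratic_poly_def right.F_def quadratic_side_def power2_eq_square field_simps)

lemma monic_sheets:
  "lead_coeff (cubic_poly z) = 1" "degree (cubic_poly z) = 3"
  "lead_coeff (quadratic_poly z) = 1" "degree (quadratic_poly z) = 2"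
  by (simp_all add: cubic_poly_def quadratic_poly_def Let_def)

text \<open>Near every point of the closed disc the fibres are the root sets of one continuous family of monic
  polynomials of a fixed degree.\<close>

lemma fiber_pinched_surface_cases:
  assumes z0: "norm z0 \<le> 1"
  shows "\<exists>P d. (\<forall>z. lead_coeff (P z) = 1 \<and> degree (P z) = d) \<and> d > 0 \<and> (\<forall>w. continuous_on UNIV (\<lambda>z. poly (P z) w)) \<and>
    (\<forall>\<^sub>F z in nhds z0. norm z \<le> 1 \<longrightarrow> fiber pinched_surface z = {w. poly (P z) w = 0})"
proof (cases "Re z0 < 1/4")
  case True
  then have "\<forall>\<^sub>F z in nhds z0. z \<in> {z. Re z < 1/4}"
    by (intro eventually_nhds_in_open open_halfspace_Re_lt) simp
  then have "\<forall>\<^sub>F z in nhds z0. norm z \<le> 1 \<longrightarrow> fiber pinched_surface z = {w. poly (cubic_poly z) w = 0}"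
    by (rule eventually_mono) (auto simp: fiber_def pinched_surface_left poly_cubic_poly)
  moreover have "continuous_on UNIV (\<lambda>z. poly (cubic_poly z) w)" for w
    unfolding poly_cubic_poly by (intro continuous_on_compose2 [OF left.continuous_on_F [of UNIV]] continuous_intros) auto
  ultimately show ?thesis
    by (intro exI [of _ cubic_poly] exI [of _ 3] conjI allI monic_sheets) simp_all
next
  case False
  then have "\<forall>\<^sub>F z in nhds z0. z \<in> {z. - 1/4 < Re z}"
    by (intro eventually_nhds_in_open open_halfspace_Re_gt) simp
  then have "\<forall>\<^sub>F z in nhds z0. norm z \<le> 1 \<longrightarrow> fiber pinched_surface z = {w. poly (quadratic_poly z) w = 0}"
    by (rule eventually_mono) (auto simp: fiber_def pinched_surface_right poly_quadratic_poly)
  moreover have "continuous_on UNIV (\<lambda>z. poly (quadratic_poly z) w)" for w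
    unfolding poly_quadratic_poly by (intro continuous_on_compose2 [OF right.continuous_on_F [of UNIV]] continuous_intros) auto
  ultimately show ?thesis
    by (intro exI [of _ quadratic_poly] exI [of _ 2] conjI allI monic_sheets) simp_all
qed

lemma finite_fiber_pinched_surface:
  assumes z: "norm z \<le> 1"
  shows "finite (fiber pinched_surface z)" "fiber pinched_surface z \<noteq> {}"
proof -
  obtain P d where P: "\<And>z. lead_coeff (P z) = 1" "\<And>z. degree (P z) = d" "d > 0"
    and "\<forall>\<^sub>F y in nhds z. norm y \<le> 1 \<longrightarrow> fiber pinched_surface y = {w. poly (P y) w = 0}"
    using fiber_pinched_surface_cases [OF z] by blast
  then have eq: "fiber pinched_surface z = {w. poly (P z) w = 0}"
    using z eventually_nhds_x_imp_x by fast
  have dz: "degree (P z) > 0" using P by simp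
  then have "P z \<noteq> 0" by auto
  then show "finite (fiber pinched_surface z)"
    unfolding eq by (rule poly_roots_finite)
  show "fiber pinched_surface z \<noteq> {}"
    unfolding eq using monic_root_near [OF P(1) dz] by blast
qed

lemma cubic_root_bound:
  fixes w a b :: complex
  assumes "w ^ 3 = a * w + b" "norm a \<le> B" "norm b \<le> B"
  shows "norm w \<le> 1 + 2 * B"
proof (rule ccontr)
  assume "\<not> ?thesis"
  then have w: "norm w > 1 + 2 * B" by simp
  have B: "B \<ge> 0" using assms(2) norm_ge_zero [of a] by linarith
  have "norm w ^ 3 = norm (a * w + b)"
    using assms(1) by (simp flip: norm_power)
  also have "\<dots> \<le> B * norm w + B * 1"
    using assms(2,3) by (intro norm_triangle_mono) (auto simp: norm_mult mult_right_mono)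
  also have "\<dots> \<le> B * norm w + B * norm w"
    using w B by (intro add_left_mono mult_left_mono) auto
  also have "\<dots> = (2 * B) * norm w" by simp
  also have "\<dots> < norm w * norm w"
    using w B by (intro mult_strict_right_mono) auto
  also have "\<dots> \<le> norm w * norm w * norm w"
    using w B mult_left_mono [of 1 "norm w" "norm w * norm w"] by simp
  finally show False by (simp add: power3_eq_cube)
qed

lemma pinched_surface_bounded:
  obtains R where "R > 0" "\<And>z w. (z, w) \<in> pinched_surface \<Longrightarrow> norm w < R"
proof -
  define a b where "a = (\<lambda>z. complex_of_real (3 * (((1 + depth z) / 2) * ((1 - depth z) / 2) * root 3 ((cmod (base_map z))\<^sup>2))))"
    and "b = (\<lambda>z. of_real (((1 + depth z) / 2) ^ 3) * base_map z + of_real (((1 - depth z) / 2) ^ 3) * cnj (base_map z))"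
  have bdd: "\<exists>B. \<forall>z. norm z \<le> 1 \<longrightarrow> norm (g z) \<le> B" if g: "continuous_on (cball 0 1) g" for g :: "complex \<Rightarrow> complex"
  proof -
    obtain B where "\<And>y. y \<in> g ` cball 0 1 \<Longrightarrow> norm y \<le> B"
      using compact_imp_bounded [OF compact_continuous_image [OF g compact_cball]] unfolding bounded_iff by blast
    then have "norm (g z) \<le> B" if "norm z \<le> 1" for z
      using that by simp
    then show ?thesis by blast
  qed
  have "continuous_on (cball 0 1) a" "continuous_on (cball 0 1) b" "continuous_on (cball 0 1) base_map"
    unfolding a_def b_def by (intro continuous_intros; simp)+
  note bdd = this [THEN bdd]
  obtain Ba where Ba: "\<forall>z. norm z \<le> 1 \<longrightarrow> norm (a z) \<le> Ba" using bdd(1) ..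
  obtain Bb where Bb: "\<forall>z. norm z \<le> 1 \<longrightarrow> norm (b z) \<le> Bb" using bdd(2) ..
  obtain Bc where Bc: "\<forall>z. norm z \<le> 1 \<longrightarrow> norm (base_map z) \<le> Bc" using bdd(3) ..
  define B where "B = max Ba (max Bb Bc)"
  have B: "norm (a z) \<le> B" "norm (b z) \<le> B" "norm (base_map z) \<le> B" if "norm z \<le> 1" for z
    using Ba Bb Bc that by (auto simp: B_def le_max_iff_disj)
  have B0: "B \<ge> 0" using order_trans [OF norm_ge_zero B(1) [of 0]] by simp
  have bound: "norm w \<le> 2 + 2 * B" if w: "(z, w) \<in> pinched_surface" for z w
  proof -
    have z: "norm z \<le> 1" using w by (simp add: pinched_surface_def)
    show ?thesis
    proof (cases "Re z \<le> 0")
      case True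
      then have "w ^ 3 = a z * w + b z"
        using w by (simp add: pinched_surface_def left.F_def cubic_side_def cardano_def a_def b_def algebra_simps)
      then have "norm w \<le> 1 + 2 * B"
        using B(1,2) [OF z] by (rule cubic_root_bound)
      then show ?thesis by simp
    next
      case False
      then have "(w - 1/4)\<^sup>2 = 9/16 * base_map z"
        using w by (simp add: pinched_surface_def right.F_def quadratic_side_def)
      then have "norm ((w - 1/4)\<^sup>2) = norm (9/16 * base_map z)"
        by (simp only:)
      then have "(norm (w - 1/4))\<^sup>2 = 9/16 * norm (base_map z)"
        by (simp add: norm_mult norm_divide norm_power)
      also have "\<dots> \<le> (1 + B)\<^sup>2"
      proof -
        have "0 \<le> B * B" using B0 by simp
        moreover have "(1 + B)\<^sup>2 = 1 + 2 * B + B * B"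
          by (simp add: power2_eq_square algebra_simps)
        ultimately show ?thesis using B(3) [OF z] B0 by linarith
      qed
      finally have "norm (w - 1/4) \<le> 1 + B"
        by (rule power2_le_imp_le) (use B0 in simp)
      moreover have "norm w \<le> norm (w - 1/4) + norm (1/4 :: complex)"
        using norm_triangle_ineq [of "w - 1/4" "1/4"] by simp
      moreover have "norm (1/4 :: complex) = 1/4" by simp
      ultimately show ?thesis using B0 by linarith
    qed
  qed
  show ?thesis
  proof (rule that [of "3 + 2 * B"])
    show "3 + 2 * B > 0" using B0 by simp
    show "norm w < 3 + 2 * B" if "(z, w) \<in> pinched_surface" for z w
      using bound [OF that] by simp
  qed
qed

lemma compact_pinched_surface: "compact pinched_surface"
proof -
  have eq: "pinched_surface = ({x. norm (fst x) \<le> 1} \<inter> {x. Re (fst x) \<le> 0} \<inter> {x. left.F x = 0})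
      \<union> ({x. norm (fst x) \<le> 1} \<inter> {x. 0 \<le> Re (fst x)} \<inter> {x. right.F x = 0})"
    using sheets_over_collar by (auto simp: pinched_surface_def)
  have "closed {x. left.F x = 0}" "closed {x. right.F x = 0}"
    using left.continuous_on_F [of UNIV] right.continuous_on_F [of UNIV]
    by (auto intro!: closed_Collect_eq)
  moreover have "closed {x::complex\<times>complex. norm (fst x) \<le> 1}" "closed {x::complex\<times>complex. Re (fst x) \<le> 0}"
    "closed {x::complex\<times>complex. 0 \<le> Re (fst x)}"
    by (intro closed_Collect_le continuous_intros)+
  ultimately have "closed pinched_surface"
    unfolding eq by (auto intro!: closed_Un closed_Int)
  moreover obtain R where "\<And>z w. (z, w) \<in> pinched_surface \<Longrightarrow> norm w < R"
    using pinched_surface_bounded by metis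
  then have "pinched_surface \<subseteq> cball 0 1 \<times> cball 0 R"
    by (force simp: pinched_surface_def)
  then have "bounded pinched_surface"
    by (rule bounded_subset [rotated]) (simp add: bounded_Times)
  ultimately show ?thesis by (simp add: compact_eq_bounded_closed)
qed

lemma hausdorff_continuous_pinched_surface:
  "hausdorff_continuous_on (cball 0 1) (fiber pinched_surface)"
proof (rule hausdorff_continuous_onI [OF compact_pinched_surface])
  fix z0 w0 :: complex and e :: real
  assume z0: "z0 \<in> cball 0 1" and w0: "w0 \<in> fiber pinched_surface z0" and e: "e > 0"
  then have nz0: "norm z0 \<le> 1" by simp
  obtain P d where P: "\<And>z. lead_coeff (P z) = 1" "\<And>z. degree (P z) = d" "d > 0" "\<And>w. continuous_on UNIV (\<lambda>z. poly (P z) w)"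
    and ev: "\<forall>\<^sub>F z in nhds z0. norm z \<le> 1 \<longrightarrow> fiber pinched_surface z = {w. poly (P z) w = 0}"
    using fiber_pinched_surface_cases [OF nz0] by blast
  have 0: "poly (P z0) w0 = 0"
    using eventually_nhds_x_imp_x [OF ev] w0 nz0 by auto
  have "((\<lambda>z. poly (P z) w0) \<longlongrightarrow> 0) (at z0 within cball 0 1)"
    using P(4) [of w0] 0 by (metis UNIV_I continuous_on_def tendsto_within_subset subset_UNIV)
  then have "\<forall>\<^sub>F z in at z0 within cball 0 1. dist (poly (P z) w0) 0 < e ^ d"
    by (rule tendstoD) (use e in simp)
  moreover have "\<forall>\<^sub>F z in at z0 within cball 0 1. norm z \<le> 1 \<longrightarrow> fiber pinched_surface z = {w. poly (P z) w = 0}"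
    using ev by (auto simp: eventually_at_filter elim: eventually_mono)
  moreover have "\<forall>\<^sub>F z in at z0 within cball 0 1. z \<in> cball 0 1"
    by (simp add: eventually_at_filter)
  ultimately show "\<forall>\<^sub>F z in at z0 within cball 0 1. \<exists>w\<in>fiber pinched_surface z. dist w0 w < e"
  proof eventually_elim
    case (elim z)
    have "degree (P z) > 0" using P by simp
    from monic_root_near [OF P(1) this] obtain w where w: "poly (P z) w = 0" "norm (w - w0) ^ d \<le> norm (poly (P z) w0)"
      unfolding P(2) .
    have "norm (w - w0) ^ d < e ^ d"
      using w(2) elim(1) by simp
    then have "norm (w - w0) < e"
      using e power_less_imp_less_base [of "norm (w - w0)" d e] by simp
    moreover have "w \<in> fiber pinched_surface z"
      using w(1) elim(2,3) by simp
    ultimately show ?case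
      by (auto simp: dist_norm norm_minus_commute)
  qed
qed (simp_all add: finite_fiber_pinched_surface)

section \<open>Simple connectivity of the complement\<close>

definition surface_complement :: "complex set \<Rightarrow> (complex \<times> complex) set"
  where "surface_complement D = D \<times> UNIV - pinched_surface"

text \<open>A point moves within its own fibre, the complement of a finite set in the plane, to a value
  \<open>w = R\<close> beyond all sheets, and then with \<open>w\<close> fixed over the convex set \<open>D\<close>.\<close>

lemma path_connected_surface_complement:
  assumes D: "convex D" "D \<subseteq> ball 0 1"
  shows "path_connected (surface_complement D)"
proof -
  obtain R where R: "R > 0" "\<And>z w. (z, w) \<in> pinched_surface \<Longrightarrow> norm w < R"
    using pinched_surface_bounded by blast
  let ?X = "surface_complement D" and ?r = "complex_of_real R"
  have far: "(z, ?r) \<in> ?X" if "z \<in> D" for z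
    using R(1) R(2) [of z ?r] that by (auto simp: surface_complement_def)
  have vertical: "path_component ?X (z, w) (z, ?r)" if zw: "(z, w) \<in> ?X" for z w
  proof -
    have z: "z \<in> D" and w: "w \<in> - fiber pinched_surface z"
      using zw by (auto simp: surface_complement_def fiber_def)
    have "norm z \<le> 1" using D(2) z by auto
    then have "path_connected (- fiber pinched_surface z)"
      using finite_fiber_pinched_surface(1) by (intro path_connected_complement_countable countable_finite) auto
    then have "path_connected (Pair z ` (- fiber pinched_surface z))"
      by (intro path_connected_continuous_image continuous_intros)
    moreover have "Pair z ` (- fiber pinched_surface z) \<subseteq> ?X"
      using z by (auto simp: surface_complement_def fiber_def)
    moreover have "?r \<in> - fiber pinched_surface z"
      using far [OF z] by (simp add: surface_complement_def fiber_def)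
    ultimately show ?thesis
      using w path_component_of_subset path_connected_component by (metis imageI)
  qed
  have horizontal: "path_component ?X (z, ?r) (z', ?r)" if "z \<in> D" "z' \<in> D" for z z'
  proof -
    have "path_connected (D \<times> {?r})"
      by (intro convex_imp_path_connected convex_Times D(1)) simp
    moreover have "D \<times> {?r} \<subseteq> ?X" using far by auto
    ultimately show ?thesis
      using that path_component_of_subset [of "D \<times> {?r}" ?X] unfolding path_connected_component by auto
  qed
  show ?thesis
    unfolding path_connected_component
  proof (intro ballI)
    fix x y assume "x \<in> ?X" "y \<in> ?X"
    moreover obtain z w z' w' where "x = (z, w)" "y = (z', w')" by (cases x, cases y)
    moreover from calculation have "z \<in> D" "z' \<in> D" by (auto simp: surface_complement_def)
    ultimately show "path_component ?X x y"
      using vertical horizontal by (meson path_component_sym path_component_trans)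
  qed
qed

definition left_disc :: "complex set" where "left_disc = {z. norm z < 1 \<and> Re z < 1/4}"
definition right_disc :: "complex set" where "right_disc = {z. norm z < 1 \<and> - 1/4 < Re z}"

lemma half_discs:
  "left_disc = ball 0 1 \<inter> {z. Re z < 1/4}" "right_disc = ball 0 1 \<inter> {z. - 1/4 < Re z}"
  by (auto simp: left_disc_def right_disc_def)

lemma left_complement: "surface_complement left_disc = left.region"
  by (auto simp: surface_complement_def left_disc_def left.region_def pinched_surface_left)

text \<open>The reflection in the imaginary axis preserves depth and branching parameter. It carries the
  results of the locale, which speak of the left part of the disc, to the quadratic side.\<close>

definition reflect :: "complex \<times> complex \<Rightarrow> complex \<times> complex"
  where "reflect x = (- cnj (fst x), snd x)"

lemma reflect_reflect [simp]: "reflect (reflect x) = x"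
  by (simp add: reflect_def)

lemma continuous_on_reflect: "continuous_on S reflect"
  unfolding reflect_def by (intro continuous_intros)

lemma right_F_reflect [simp]: "right.F (reflect x) = right.F x"
  by (simp add: right.F_def reflect_def base_map_def depth_def)

lemma reflect_right_complement: "reflect x \<in> surface_complement right_disc \<longleftrightarrow> x \<in> right.region"
proof -
  have "norm (- cnj (fst x)) = norm (fst x)" by simp
  then have "reflect x \<in> surface_complement right_disc \<longleftrightarrow> norm (fst x) < 1 \<and> Re (fst x) < 1/4 \<and> right.F (reflect x) \<noteq> 0"
    by (auto simp: surface_complement_def right_disc_def reflect_def pinched_surface_right)
  then show ?thesis by (simp add: right.region_def)
qed

lemma right_loops_classified:
  assumes p: "path p" "path_image p \<subseteq> surface_complement right_disc" "pathfinish p = pathstart p"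
    and q: "path q" "path_image q \<subseteq> surface_complement right_disc" "pathfinish q = pathstart q"
    and eq: "winding_number (right.F \<circ> p) 0 = winding_number (right.F \<circ> q) 0"
  shows "homotopic_loops (surface_complement right_disc) p q"
proof -
  have rr: "reflect \<circ> (reflect \<circ> r) = r" and Fr: "right.F \<circ> (reflect \<circ> r) = right.F \<circ> r" for r :: "real \<Rightarrow> complex \<times> complex"
    by (simp_all add: fun_eq_iff)
  have im: "path (reflect \<circ> r)" "path_image (reflect \<circ> r) \<subseteq> right.region" "pathfinish (reflect \<circ> r) = pathstart (reflect \<circ> r)"
    if "path r" "path_image r \<subseteq> surface_complement right_disc" "pathfinish r = pathstart r" for r
  proof -
    show "path (reflect \<circ> r)"
      by (rule path_continuous_image [OF that(1) continuous_on_reflect])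
    show "path_image (reflect \<circ> r) \<subseteq> right.region"
      using that(2) reflect_right_complement [of "reflect _"] by (auto simp: path_image_compose)
    show "pathfinish (reflect \<circ> r) = pathstart (reflect \<circ> r)"
      using that(3) by (simp add: pathfinish_compose pathstart_compose)
  qed
  have "homotopic_loops right.region (reflect \<circ> p) (reflect \<circ> q)"
    using eq by (intro right.loops_classified_by_winding im p q) (simp add: Fr)
  then have "homotopic_loops (surface_complement right_disc) (reflect \<circ> (reflect \<circ> p)) (reflect \<circ> (reflect \<circ> q))"
    by (rule homotopic_loops_continuous_image [OF _ continuous_on_reflect]) (simp add: reflect_right_complement)
  then show ?thesis by (simp only: rr)
qed

text \<open>A loop over \<open>z = 0\<close> based at \<open>w = 1/4\<close>, the midpoint of the two constant sheets: it runs \<open>m\<close> times around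
  \<open>1\<close> and then \<open>n\<close> times around \<open>-1/2\<close>.\<close>

definition collar_loop :: "int \<Rightarrow> int \<Rightarrow> real \<Rightarrow> complex \<times> complex"
  where "collar_loop m n = Pair 0 \<circ> ((\<lambda>t. 1 - circle_loop (3/4) m t) +++ (\<lambda>t. - 1/2 + circle_loop (3/4) n t))"

text \<open>The decisive numbers of the construction: the sheet \<open>-1/2\<close> counts twice for the cubic and once for
  the quadratic, and the resulting pairs \<open>(m + 2 n, m + n)\<close> exhaust all pairs of integers.\<close>

lemma collar_loop:
  shows "path (collar_loop m n)" "pathfinish (collar_loop m n) = pathstart (collar_loop m n)"
    and "path_image (collar_loop m n) \<subseteq> surface_complement (left_disc \<inter> right_disc)"
    and "winding_number (left.F \<circ> collar_loop m n) 0 = of_int (m + 2 * n)"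
    and "winding_number (right.F \<circ> collar_loop m n) 0 = of_int (m + n)"
proof -
  define k where "k = circle_loop (3/4)"
  \<comment> \<open>up to sign, the difference to the sheet that the circle does not enclose\<close>
  define c where "c = (\<lambda>j t. of_real (- 3/2) + k j t)"
  have path: "path (k j)" "path (c j)" for j
    by (auto simp: k_def c_def path_def intro!: continuous_intros)
  have nz: "k j t \<noteq> 0" "c j t \<noteq> 0" for j t
  proof -
    have n: "norm (k j t) = 3/4" by (simp add: k_def)
    then show "k j t \<noteq> 0" by auto
    show "c j t \<noteq> 0"
    proof
      assume "c j t = 0"
      then have "k j t = of_real (3/2)" by (simp add: c_def add_eq_0_iff)
      then have "norm (k j t) = 3/2" by (simp only: norm_of_real)
      with n show False by simp
    qed
  qed
  have wind: "winding_number (k j) 0 = of_int j" "winding_number (c j) 0 = 0" for j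
    using winding_number_circle_loop [of "3/4" j] winding_number_offset_circle [of "3/4" "- 3/2" j]
    by (simp_all add: k_def c_def)
  have mult: "path (\<lambda>t. f t * g t)" "0 \<notin> path_image (\<lambda>t. f t * g t)"
    "winding_number (\<lambda>t. f t * g t) 0 = winding_number f 0 + winding_number g 0"
    if "path f" "path g" "0 \<notin> path_image f" "0 \<notin> path_image g" for f g :: "real \<Rightarrow> complex"
    using that winding_number_mult [OF that] by (auto simp: path_def path_image_def intro!: continuous_intros)
  have im: "0 \<notin> path_image (k j)" "0 \<notin> path_image (c j)" for j
    using nz [of j] by (auto simp: path_image_def)
  define a b where "a = (\<lambda>t. 1 - k m t)" and "b = (\<lambda>t. - 1/2 + k n t)"
  have pab: "path (Pair (0::complex) \<circ> a)" "path (Pair (0::complex) \<circ> b)"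
    using path by (auto simp: a_def b_def path_def o_def intro!: continuous_intros)
  have ends: "pathstart a = 1/4" "pathfinish a = 1/4" "pathstart b = 1/4" "pathfinish b = 1/4"
    by (simp_all add: a_def b_def k_def pathstart_def pathfinish_def complex_eq_iff)
  have loop: "collar_loop m n = (Pair 0 \<circ> a) +++ (Pair 0 \<circ> b)"
    unfolding path_compose_join [symmetric] by (simp add: collar_loop_def a_def b_def k_def)
  show pl: "path (collar_loop m n)" "pathfinish (collar_loop m n) = pathstart (collar_loop m n)"
    unfolding loop using pab by (simp_all add: pathfinish_compose pathstart_compose ends)
  have F: "left.F (0, w) = (w - 1) * (w + 1/2)\<^sup>2" "right.F (0, w) = (w - 1) * (w + 1/2)" for w
    using sheets_over_collar [of 0 w] by simp_all
  have La: "left.F \<circ> (Pair 0 \<circ> a) = (\<lambda>t. (-1) * (k m t * (c m t * c m t)))"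
    and Ra: "right.F \<circ> (Pair 0 \<circ> a) = (\<lambda>t. k m t * c m t)"
    and Lb: "left.F \<circ> (Pair 0 \<circ> b) = (\<lambda>t. c n t * (k n t * k n t))"
    and Rb: "right.F \<circ> (Pair 0 \<circ> b) = (\<lambda>t. c n t * k n t)"
    by (simp_all add: fun_eq_iff F a_def b_def c_def power2_eq_square field_simps)
  have nzF: "left.F (0, a t) \<noteq> 0" "left.F (0, b t) \<noteq> 0" for t
    using fun_cong [OF La, of t] fun_cong [OF Lb, of t] nz by simp_all
  show "path_image (collar_loop m n) \<subseteq> surface_complement (left_disc \<inter> right_disc)"
  proof -
    have "path_image (collar_loop m n) = path_image (Pair 0 \<circ> a) \<union> path_image (Pair 0 \<circ> b)"
      unfolding loop by (intro path_image_join) (simp add: pathfinish_compose pathstart_compose ends)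
    then show ?thesis
      using nzF by (auto simp: path_image_def surface_complement_def left_disc_def right_disc_def pinched_surface_left)
  qed
  have L: "left.F \<circ> collar_loop m n = (left.F \<circ> (Pair 0 \<circ> a)) +++ (left.F \<circ> (Pair 0 \<circ> b))"
    and R: "right.F \<circ> collar_loop m n = (right.F \<circ> (Pair 0 \<circ> a)) +++ (right.F \<circ> (Pair 0 \<circ> b))"
    by (simp_all only: loop path_compose_join)
  have fin: "pathfinish (f \<circ> (Pair 0 \<circ> a)) = pathstart (f \<circ> (Pair (0::complex) \<circ> b))" for f :: "complex \<times> complex \<Rightarrow> complex"
    by (simp add: pathfinish_compose pathstart_compose ends)
  note cc = mult [OF path(2) path(2) im(2) im(2), of m m]
  note kcc = mult [OF path(1) cc(1) im(1) cc(2), of m]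
  note kk = mult [OF path(1) path(1) im(1) im(1), of n n]
  note ckk = mult [OF path(2) kk(1) im(2) kk(2), of n]
  have one: "path (\<lambda>t. - 1 :: complex)" "0 \<notin> path_image (\<lambda>t. - 1 :: complex)"
    by (auto simp: path_def path_image_def)
  note mkcc = mult [OF one(1) kcc(1) one(2) kcc(2)]
  have w1: "winding_number (\<lambda>t. (-1) * (k m t * (c m t * c m t))) 0 = of_int m"
    using winding_number_cmult [OF kcc(1,2), of "-1"] kcc(3) cc(3) wind by simp
  show "winding_number (left.F \<circ> collar_loop m n) 0 = of_int (m + 2 * n)"
    unfolding L using fin [of left.F] unfolding La Lb
    by (subst winding_number_join [OF mkcc(1,2) ckk(1,2)]) (simp_all add: w1 [simplified] ckk(3) kk(3) wind)
  note kc = mult [OF path(1) path(2) im(1) im(2), of m m]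
  note ck = mult [OF path(2) path(1) im(2) im(1), of n n]
  show "winding_number (right.F \<circ> collar_loop m n) 0 = of_int (m + n)"
    unfolding R using fin [of right.F] unfolding Ra Rb
    by (subst winding_number_join [OF kc(1,2) ck(1,2)]) (simp_all add: kc(3) ck(3) wind)
qed

theorem simply_connected_surface_complement:
  "simply_connected (surface_complement (ball 0 1))"
proof (rule simply_connected_Un)
  let ?X = "surface_complement (ball 0 1)" and ?U = "surface_complement left_disc" and ?V = "surface_complement right_disc"
  show "?X = ?U \<union> ?V"
    by (auto simp: surface_complement_def left_disc_def right_disc_def)
  have sub: "?U \<subseteq> ?X" "?V \<subseteq> ?X"
    by (auto simp: surface_complement_def left_disc_def right_disc_def)
  have UV: "?U \<inter> ?V = surface_complement (left_disc \<inter> right_disc)"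
    by (auto simp: surface_complement_def)
  have "open (surface_complement D)" if "open D" for D
    using that compact_imp_closed [OF compact_pinched_surface] by (auto simp: surface_complement_def open_Times)
  note op = this
  have "open ?U" "open ?V"
    unfolding half_discs
    by (rule op, intro open_Int open_ball open_halfspace_Re_lt open_halfspace_Re_gt)+
  then show "openin (top_of_set ?X) ?U" "openin (top_of_set ?X) ?V"
    using sub by (simp_all add: open_subset)
  show "path_connected ?U" "path_connected ?V" "path_connected (?U \<inter> ?V)"
    unfolding UV unfolding half_discs
    by (intro path_connected_surface_complement convex_Int convex_ball convex_halfspace_Re_lt convex_halfspace_Re_gt; auto)+
  have start: "pathstart (collar_loop m n) \<in> ?U \<inter> ?V" for m n
    using collar_loop(3) [of m n] UV by blast
  then show "?U \<inter> ?V \<noteq> {}" by blast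
  have const: "path (linepath x x)" "path_image (linepath x x) \<subseteq> S" "pathfinish (linepath x x) = pathstart (linepath x x)"
    if "x \<in> S" for x :: "complex \<times> complex" and S
    using that by auto
  have wconst: "winding_number (f \<circ> linepath x x) 0 = 0" if "f x \<noteq> 0" for f and x :: "complex \<times> complex"
    using winding_number_const [OF that] by (simp add: o_def linepath_def)
  have cU: "path_image (collar_loop m n) \<subseteq> ?U" and cV: "path_image (collar_loop m n) \<subseteq> ?V" for m n
    using collar_loop(3) [of m n] UV by blast+
  show "\<exists>a. homotopic_loops ?X p (linepath a a)"
    if p: "path p" "path_image p \<subseteq> ?U" "pathfinish p = pathstart p" for p
  proof -
    have "winding_number (left.F \<circ> p) 0 \<in> \<int>"
      using p path_continuous_image [OF p(1) left.continuous_on_F]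
      by (intro integer_winding_number)
        (auto simp: path_image_compose pathfinish_compose pathstart_compose left_complement left.region_def)
    then obtain n where n: "winding_number (left.F \<circ> p) 0 = of_int n"
      using Ints_cases by blast
    \<comment> \<open>cubic winding number \<open>n\<close>, quadratic winding number \<open>0\<close>\<close>
    let ?e = "collar_loop (- n) n"
    let ?a = "pathstart ?e"
    have "homotopic_loops ?U p ?e"
      unfolding left_complement using p cU [of "- n" n] collar_loop(4) [of "- n" n] n
      by (intro left.loops_classified_by_winding) (auto simp: collar_loop left_complement)
    from homotopic_loops_subset [OF this sub(1)] have "homotopic_loops ?X p ?e" .
    moreover have "homotopic_loops ?V ?e (linepath ?a ?a)"
    proof (rule right_loops_classified [OF collar_loop(1) cV collar_loop(2) const])
      have "right.F ?a \<noteq> 0"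
        using start [of "- n" n] reflect_right_complement [of "reflect ?a"] by (auto simp: right.region_def)
      then show "winding_number (right.F \<circ> ?e) 0 = winding_number (right.F \<circ> linepath ?a ?a) 0"
        by (simp add: collar_loop(5) wconst)
    qed (use start in auto)
    from homotopic_loops_subset [OF this sub(2)] have "homotopic_loops ?X ?e (linepath ?a ?a)" .
    ultimately show ?thesis
      using homotopic_loops_trans by blast
  qed
  show "\<exists>a. homotopic_loops ?X p (linepath a a)"
    if p: "path p" "path_image p \<subseteq> ?V" "pathfinish p = pathstart p" for p
  proof -
    have "right.F x \<noteq> 0" if "x \<in> ?V" for x
      using that reflect_right_complement [of "reflect x"] by (auto simp: right.region_def)
    then have "winding_number (right.F \<circ> p) 0 \<in> \<int>"
      using p path_continuous_image [OF p(1) right.continuous_on_F]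
      by (intro integer_winding_number) (auto simp: path_image_compose pathfinish_compose pathstart_compose)
    then obtain n where n: "winding_number (right.F \<circ> p) 0 = of_int n"
      using Ints_cases by blast
    \<comment> \<open>cubic winding number \<open>0\<close>, quadratic winding number \<open>n\<close>\<close>
    let ?e = "collar_loop (2 * n) (- n)"
    let ?a = "pathstart ?e"
    have "homotopic_loops ?V p ?e"
      using n by (intro right_loops_classified p cV collar_loop(1,2)) (simp add: collar_loop(5))
    from homotopic_loops_subset [OF this sub(2)] have "homotopic_loops ?X p ?e" .
    moreover have "homotopic_loops ?U ?e (linepath ?a ?a)"
      unfolding left_complement
    proof (rule left.loops_classified_by_winding [OF collar_loop(1) _ collar_loop(2)])
      show "path_image ?e \<subseteq> left.region" using cU left_complement by simp
      have a: "?a \<in> left.region" using start [of "2 * n" "- n"] left_complement by auto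
      then show "path (linepath ?a ?a)" "path_image (linepath ?a ?a) \<subseteq> left.region" "pathfinish (linepath ?a ?a) = pathstart (linepath ?a ?a)"
        by auto
      show "winding_number (left.F \<circ> ?e) 0 = winding_number (left.F \<circ> linepath ?a ?a) 0"
        using a by (simp add: collar_loop(4) wconst left.region_def)
    qed
    from homotopic_loops_subset [OF this sub(1)] have "homotopic_loops ?X ?e (linepath ?a ?a)" .
    ultimately show ?thesis
      using homotopic_loops_trans by blast
  qed
qed

section \<open>Pseudopolynomials near the surface\<close>

text \<open>The homotopy \<open>s\<^sup>m P(w/s)\<close> leads from \<open>w\<^sup>m\<close> to \<open>P(w)\<close> and has no zeros for \<open>\<bar>w\<bar> = R\<close>, because then
  \<open>\<bar>w/s\<bar> \<ge> R\<close>.\<close>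

lemma pseudopolynomial_winding:
  fixes a :: "nat \<Rightarrow> complex"
  assumes "R > 0" and nz: "\<And>w. R \<le> norm w \<Longrightarrow> w ^ m + (\<Sum>k=1..m. a k * w ^ (m - k)) \<noteq> 0"
  shows "winding_number (\<lambda>t. circle_loop R 1 t ^ m + (\<Sum>k=1..m. a k * circle_loop R 1 t ^ (m - k))) 0 = of_nat m"
proof -
  let ?c = "circle_loop R 1"
  define h where "h = (\<lambda>s t. ?c t ^ m + (\<Sum>k=1..m. a k * of_real s ^ k * ?c t ^ (m - k)))"
  have "winding_number (\<lambda>t. ?c t ^ m) 0 = winding_number (\<lambda>t. ?c t ^ m + (\<Sum>k=1..m. a k * ?c t ^ (m - k))) 0"
  proof (rule winding_number_eq_homotopy [where h = h])
    show "continuous_on ({0..1} \<times> {0..1}) (\<lambda>x. h (fst x) (snd x))"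
      unfolding h_def by (intro continuous_intros)
    have h0: "h 0 t = ?c t ^ m" for t
      unfolding h_def by (simp add: power_0_left)
    then show "h 0 t = ?c t ^ m" for t .
    show "h s t \<noteq> 0" if "s \<in> {0..1}" for s t
    proof (cases "s = 0")
      case True
      have "norm (?c t) = R" using \<open>R > 0\<close> by simp
      then have "?c t \<noteq> 0" using \<open>R > 0\<close> by (metis less_irrefl norm_zero)
      then show ?thesis using True h0 by simp
    next
      case False
      let ?w = "?c t / of_real s"
      have s: "0 < s" "s \<le> 1" using that False by auto
      then have "R \<le> norm ?w"
        using \<open>R > 0\<close> by (simp add: norm_divide le_divide_eq mult_left_le)
      then have "?w ^ m + (\<Sum>k=1..m. a k * ?w ^ (m - k)) \<noteq> 0" by (rule nz)
      moreover have "h s t = of_real s ^ m * (?w ^ m + (\<Sum>k=1..m. a k * ?w ^ (m - k)))"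
      proof -
        have A: "of_real s ^ m * ?w ^ m = ?c t ^ m"
          using s by (simp add: power_divide)
        have B: "of_real s ^ m * (a k * ?w ^ (m - k)) = a k * of_real s ^ k * ?c t ^ (m - k)" if "k \<in> {1..m}" for k
        proof -
          have "complex_of_real s ^ m = of_real s ^ k * of_real s ^ (m - k)"
            using that by (simp flip: power_add)
          then show ?thesis
            using s by (simp add: power_divide)
        qed
        have "of_real s ^ m * (?w ^ m + (\<Sum>k=1..m. a k * ?w ^ (m - k)))
            = of_real s ^ m * ?w ^ m + (\<Sum>k=1..m. of_real s ^ m * (a k * ?w ^ (m - k)))"
          by (simp only: distrib_left sum_distrib_left)
        also have "\<dots> = h s t"
          unfolding h_def by (rule arg_cong2 [where f = "(+)", OF A sum.cong [OF refl B]])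
        finally show ?thesis by (rule sym)
      qed
      ultimately show ?thesis using s by simp
    qed
    show "h s 1 = h s 0" for s
      by (simp add: h_def)
    show "h 1 t = ?c t ^ m + (\<Sum>k=1..m. a k * ?c t ^ (m - k))" for t
      by (simp add: h_def)
  qed
  moreover have "(\<lambda>t. ?c t ^ m) = circle_loop (R ^ m) (int m)"
    by (simp add: fun_eq_iff circle_loop_def power_mult_distrib mult_ac flip: exp_of_nat_mult)
  ultimately show ?thesis
    using winding_number_circle_loop [of "R ^ m" "int m"] \<open>R > 0\<close> by simp
qed

lemma neighbourhood_without_pseudopolynomial:
  assumes E: "E \<subseteq> UNIV \<times> ball 0 R" and "R > 0"
    and sc: "simply_connected (ball 0 1 \<times> UNIV - E)"
  shows "\<exists>U. open U \<and> E \<subseteq> U \<and> (\<forall>S. weierstrass_pseudopolynomial_set S \<longrightarrow> \<not> S \<subseteq> U)"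
proof -
  let ?X = "ball 0 1 \<times> UNIV - E"
  define L where "L = (\<lambda>t. (0 :: complex, circle_loop R 1 t))"
  have "path L" "pathfinish L = pathstart L" "path_image L \<subseteq> ?X"
    using \<open>R > 0\<close> E
    by (auto simp: L_def path_def path_image_def pathstart_def pathfinish_def intro!: continuous_intros)
  then have "homotopic_loops ?X L (linepath (L 0) (L 0))"
    using sc unfolding simply_connected_eq_contractible_loop_any
    by (metis pathstart_def pathstart_in_path_image subsetD)
  then have "\<exists>h. continuous_on ({0..1::real} \<times> {0..1}) h \<and> h \<in> {0..1} \<times> {0..1} \<rightarrow> ?X \<and> (\<forall>x\<in>{0..1}. h (0, x) = L x)
      \<and> (\<forall>x\<in>{0..1}. h (1, x) = L 0) \<and> (\<forall>t\<in>{0..1}. h (t, 1) = h (t, 0))"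
    by (simp add: homotopic_loops pathstart_def pathfinish_def linepath_refl)
  then obtain h where h: "continuous_on ({0..1::real} \<times> {0..1}) h" "h \<in> {0..1} \<times> {0..1} \<rightarrow> ?X"
    and h01: "\<forall>x\<in>{0..1}. h (0, x) = L x" "\<forall>x\<in>{0..1}. h (1, x) = L 0"
    and hl: "\<forall>t\<in>{0..1}. h (t, 1) = h (t, 0)"
    by blast
  define K where "K = h ` ({0..1} \<times> {0..1})"
  have "K \<subseteq> ?X"
    unfolding K_def image_subset_iff_funcset by (rule h(2))
  moreover have "compact K"
    unfolding K_def by (intro compact_continuous_image h(1) compact_Times compact_Icc)
  ultimately have K: "compact K" "K \<subseteq> ?X" by simp_all
  have LK: "homotopic_loops K L (\<lambda>t. L 0)"
    by (rule homotopic_loopsI [where h = "\<lambda>s t. h (s, t)"]) (use h(1) h01 hl in \<open>auto simp: K_def\<close>)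
  \<comment> \<open>the bound on \<open>w\<close> forces all the zeros over \<open>z = 0\<close> inside the big circle\<close>
  define U where "U = {x. norm (snd x) < R} \<inter> - K"
  have "open U"
    unfolding U_def using K(1) by (intro open_Int open_Collect_less continuous_intros open_Compl compact_imp_closed)
  moreover have "E \<subseteq> U"
    using E K(2) by (auto simp: U_def)
  moreover have "\<not> S \<subseteq> U" if wS: "weierstrass_pseudopolynomial_set S" for S
  proof
    assume SU: "S \<subseteq> U"
    obtain m :: nat and a :: "nat \<Rightarrow> complex \<Rightarrow> complex" where "m \<ge> 1 \<and> (\<forall>k\<in>{1..m}. continuous_on (cball 0 1) (a k)) \<and>
        S = {(z, w). z \<in> cball 0 1 \<and> w ^ m + (\<Sum>k=1..m. a k z * w ^ (m - k)) = 0}"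
      using wS unfolding weierstrass_pseudopolynomial_set_def by (elim exE) (rule that)
    then have m: "m \<ge> 1" and a: "\<And>k. k \<in> {1..m} \<Longrightarrow> continuous_on (cball 0 1) (a k)"
      and S: "S = {(z, w). z \<in> cball 0 1 \<and> w ^ m + (\<Sum>k=1..m. a k z * w ^ (m - k)) = 0}"
      by simp_all
    define P where "P = (\<lambda>x. snd x ^ m + (\<Sum>k=1..m. a k (fst x) * snd x ^ (m - k)))"
    have nz: "P x \<noteq> 0" if "fst x \<in> cball 0 1" "x \<notin> U" for x
      using that SU by (cases x) (auto simp: S P_def)
    have K01: "fst x \<in> cball 0 1" "x \<notin> U" if "x \<in> K" for x
      using that K(2) by (auto simp: U_def)
    have "continuous_on K P"
      unfolding P_def
      by (intro continuous_intros continuous_on_compose2 [OF a]) (use K01 in auto)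
    then have "homotopic_loops (- {0}) (P \<circ> L) (P \<circ> (\<lambda>t. L 0))"
      using nz K01 by (intro homotopic_loops_continuous_image [OF LK]) auto
    from winding_number_homotopic_loops [OF this]
    have "winding_number (P \<circ> L) 0 = winding_number (\<lambda>t. P (L 0)) 0"
      by (simp add: o_def)
    also have "\<dots> = 0"
    proof (rule winding_number_const)
      have "L 0 \<in> K" using h01(1) by (force simp: K_def)
      then show "P (L 0) \<noteq> 0" using nz K01 by blast
    qed
    also have "winding_number (P \<circ> L) 0 = of_nat m"
    proof -
      have "w ^ m + (\<Sum>k=1..m. a k 0 * w ^ (m - k)) \<noteq> 0" if "R \<le> norm w" for w
        using nz [of "(0, w)"] that by (simp add: U_def P_def)
      from pseudopolynomial_winding [OF \<open>R > 0\<close> this]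
      show ?thesis by (simp add: P_def L_def o_def)
    qed
    finally show False using m by simp
  qed
  ultimately show ?thesis by blast
qed

theorem mainTheorem3:
  shows "\<exists>E :: (complex \<times> complex) set.
    compact E \<and> E \<subseteq> cball 0 1 \<times> UNIV \<and>
    (\<forall>z\<in>cball 0 1. finite (fiber E z) \<and> fiber E z \<noteq> {}) \<and>
    hausdorff_continuous_on (cball 0 1) (fiber E) \<and>
    trivial_group (homology_group 1 (top_of_set (ball 0 1 \<times> UNIV - E))) \<and>
    (\<exists>U. open U \<and> E \<subseteq> U \<and>
      (\<forall>S. weierstrass_pseudopolynomial_set S \<longrightarrow> \<not> S \<subseteq> U))"
proof (rule exI [of _ pinched_surface], intro conjI)
  show "compact pinched_surface"
    by (rule compact_pinched_surface)
  show "pinched_surface \<subseteq> cball 0 1 \<times> UNIV"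
    by (auto simp: pinched_surface_def)
  show "\<forall>z\<in>cball 0 1. finite (fiber pinched_surface z) \<and> fiber pinched_surface z \<noteq> {}"
    by (simp add: finite_fiber_pinched_surface)
  show "hausdorff_continuous_on (cball 0 1) (fiber pinched_surface)"
    by (rule hausdorff_continuous_pinched_surface)
  have sc: "simply_connected (ball 0 1 \<times> UNIV - pinched_surface)"
    using simply_connected_surface_complement by (simp only: surface_complement_def)
  then show "trivial_group (homology_group 1 (top_of_set (ball 0 1 \<times> UNIV - pinched_surface)))"
    by (rule trivial_homology_group_simply_connected)
  obtain R where R: "R > 0" "\<And>z w. (z, w) \<in> pinched_surface \<Longrightarrow> norm w < R"
    using pinched_surface_bounded by blast
  have "pinched_surface \<subseteq> UNIV \<times> ball 0 R"
    using R(2) by auto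
  then show "\<exists>U. open U \<and> pinched_surface \<subseteq> U \<and> (\<forall>S. weierstrass_pseudopolynomial_set S \<longrightarrow> \<not> S \<subseteq> U)"
    using R(1) sc by (rule neighbourhood_without_pseudopolynomial)
qed

end
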